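(* Suppose Assumptions A1 and A3 hold, and let $\mathbf z^*$ be any optimal solution of the dual problem (D). Then the map $\mathbb R^N\ni\mathbf z\mapsto\gamma_{\boldsymbol\varphi}(\mathbf z):=\int\langle\boldsymbol\varphi(\mathbf y),\mathbf T_{\mathbf z}(\mathbf y)\rangle\,dR(\mathbf y)$ is Fréchet differentiable at $\mathbf z^*$ with derivative $$[\gamma_{\boldsymbol\varphi}]'_{\mathbf z^*}(\mathbf h)=\sum_{1\le i<j\le N}\frac{h_i-h_j}{\|\mathbf x_i-\mathbf x_j\|}\int_{D_{ij}}\langle\mathbf x_i-\mathbf x_j,\boldsymbol\varphi(\mathbf y)\rangle\,\rho(\mathbf y)\,d\mathcal H^{d-1}(\mathbf y),\qquad \mathbf h=(h_1,\dots,h_N)^\top\in\mathbb R^N.$$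
   Context: Setting: $R$ is a Borel probability measure on $\mathbb R^d$ and $P$ is a probability measure on $\mathbb R^d$ with finite support $\{\mathbf x_1,\dots,\mathbf x_N\}$ (distinct points) and weights $p_i=P(\{\mathbf x_i\})>0$. Assumption A1: $R$ is compactly supported and absolutely continuous with Lebesgue density $\rho$ that is continuous on a compact convex set $\mathcal Y$ containing the support of $R$ ($\rho=0$ off $\mathcal Y$); moreover $\mathcal Y$ is either polyhedral or satisfies $\mathcal H^{d-1}(\partial\mathcal Y\cap H)=0$ for every hyperplane $H$. Assumption A3: $\boldsymbol\varphi:\mathbb R^d\to\mathbb R^d$ is a bounded Borel vector field whose set of discontinuity points has Hausdorff dimension strictly less than $d-1$. Dual problem (D): maximize over $\mathbf z\in\mathbb R^N$ the function $\langle\mathbf z,\mathbf p\rangle+\int\min_{i}\big(\tfrac12\|\mathbf y-\mathbf x_i\|^2-z_i\big)\,dR(\mathbf y)$. For $\mathbf z\in\mathbb R^N$ let $b_{ij}(\mathbf z)=(\|\mathbf x_i\|^2-\|\mathbf x_j\|^2)/2-z_i+z_j$, Laguerre cells $C_i(\mathbf z)=\bigcap_{j\neq i}\{\mathbf y:\langle\mathbf x_i-\mathbf x_j,\mathbf y\rangle\ge b_{ij}(\mathbf z)\}$, and $\mathbf T_{\mathbf z}(\mathbf y)=\operatorname{argmin}_{\mathbf x_i}\big(\tfrac12\|\mathbf y-\mathbf x_i\|^2-z_i\big)$ ($R$-a.e. defined). Write $C_i=C_i(\mathbf z^* )$ and $D_{ij}=C_i\cap C_j$; $\mathcal H^{d-1}$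 is $(d-1)$-dimensional Hausdorff measure. *)

theory Defs
  imports "HOL-Probability.Probability"
begin

text \<open>Contribution of one covering set: omega_s (diam C / 2)^s, with the convention
  that the empty set contributes 0 and t^0 = 1.\<close>
definition haus_gauge :: "real \<Rightarrow> 'a::metric_space set \<Rightarrow> real" where
  "haus_gauge s C = (if C = {} then 0
      else if s = 0 then 1 else unit_ball_vol s * (diameter C / 2) powr s)"

definition hausdorff_outer_delta :: "real \<Rightarrow> real \<Rightarrow> 'a::metric_space set \<Rightarrow> ennreal" where
  "hausdorff_outer_delta s \<delta> A =
     (INF C \<in> {C :: nat \<Rightarrow> 'a set. A \<subseteq> (\<Union>i. C i) \<and>
                  (\<forall>i. bounded (C i) \<and> diameter (C i) \<le> \<delta>)}.
        (\<Sum>i. ennreal (haus_gauge s (C i))))"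

definition hausdorff_outer :: "real \<Rightarrow> 'a::metric_space set \<Rightarrow> ennreal" where
  "hausdorff_outer s A = (SUP \<delta> \<in> {0<..}. hausdorff_outer_delta s \<delta> A)"

definition hausdorff_measure :: "real \<Rightarrow> 'a::metric_space measure" where
  "hausdorff_measure s = measure_of UNIV (sets borel) (hausdorff_outer s)"

definition hausdorff_dimension :: "'a::metric_space set \<Rightarrow> real" where
  "hausdorff_dimension A = Inf {s. s \<ge> 0 \<and> hausdorff_outer s A = 0}"

definition dual_obj :: "('n::finite \<Rightarrow> 'a::euclidean_space) \<Rightarrow> ('n \<Rightarrow> real) \<Rightarrow> 'a measure
     \<Rightarrow> real^'n \<Rightarrow> real" where
  "dual_obj x p R z = (\<Sum>i\<in>UNIV. z $ i * p i)
      + (\<integral>y. Min ((\<lambda>i. (norm (y - x i))\<^sup>2 / 2 - z $ i) ` UNIV) \<partial>R)"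

definition b_coef :: "('n::finite \<Rightarrow> 'a::euclidean_space) \<Rightarrow> real^'n \<Rightarrow> 'n \<Rightarrow> 'n \<Rightarrow> real" where
  "b_coef x z i j = ((norm (x i))\<^sup>2 - (norm (x j))\<^sup>2) / 2 - z $ i + z $ j"

definition laguerre_cell :: "('n::finite \<Rightarrow> 'a::euclidean_space) \<Rightarrow> real^'n \<Rightarrow> 'n \<Rightarrow> 'a set" where
  "laguerre_cell x z i = (\<Inter>j \<in> UNIV - {i}. {y. inner (x i - x j) y \<ge> b_coef x z i j})"

text \<open>The transport map T_z: a (fixed, Hilbert-choice) selection of the argmin;
  it is R-a.e. unique under A1.\<close>
definition transport_map :: "('n::finite \<Rightarrow> 'a::euclidean_space) \<Rightarrow> real^'n \<Rightarrow> 'a \<Rightarrow> 'a" where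
  "transport_map x z y = x (SOME i. \<forall>j. (norm (y - x i))\<^sup>2 / 2 - z $ i \<le> (norm (y - x j))\<^sup>2 / 2 - z $ j)"

definition gamma_phi :: "('n::finite \<Rightarrow> 'a::euclidean_space) \<Rightarrow> 'a measure \<Rightarrow> ('a \<Rightarrow> 'a) \<Rightarrow> real^'n \<Rightarrow> real" where
  "gamma_phi x R \<phi> z = (\<integral>y. inner (\<phi> y) (transport_map x z y) \<partial>R)"

end

theory Submission
  imports Defs
begin

text \<open>Passing from \<open>z\<close> to \<open>z + h\<close> moves mass only between pairs of cells, so
  \<open>\<gamma>(z + h) - \<gamma>(z)\<close> is the sum over \<open>i, j\<close> of the integrals of \<open>\<langle>\<phi>, x i - x j\<rangle> \<rho>\<close> over
  \<open>C i (z + h) \<inter> C j (z)\<close>.  This set lies in a slab of width \<open>(h i - h j) / |x i - x j|\<close> next to the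
  bisecting hyperplane of \<open>x i\<close> and \<open>x j\<close>, and is negligible if \<open>h i \<le> h j\<close>.  In coordinates adapted to the
  hyperplane, with the normal coordinate rescaled by the width, dominated convergence shows
  that the integral divided by the width tends to the integral over \<open>D i j\<close>.

  Pointwise convergence of the integrand is needed at almost every point of the hyperplane.
  Optimality of \<open>z\<close> gives all cells positive mass, and this excludes the bad cases:
  a third cell touches the interface \<open>D i j\<close> only in codimension two, and the hyperplane meets the
  interior of the convex set \<open>Y\<close>, hence its boundary only in a null set.

  The Hausdorff measure on the hyperplane is identified with Lebesgue measure in one dimension less
  by Vitali's covering theorem and the isodiametric inequality, the latter by Steiner symmetrization.
  Since it is isometry invariant, the same identification in full dimension also shows that Lebesgue
  measure is preserved by the change to the adapted coordinates.\<close>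

section \<open>Hausdorff measures on Borel sets\<close>

text \<open>The contribution of an ordered pair is one-sided: to first order it is max 0 (h i - h j)
  / |x i - x j| times the interface integral, which is not linear in h. Linearity appears only when
  (i, j) is joined with (j, i), since the interface integral changes sign and max 0 a - max 0 (- a)
  = a. The limit is taken along every sequence h tending to 0 in the half-space h i > h j, with no
  relation between the speed of h i - h j and that of the other components. This gives the
  uniformity in the direction that a Frechet derivative requires. The other components only perturb
  strict inequalities, which persist; the comparison of i with j is a tie in the limit and has to be
  settled exactly, which the rescaled normal coordinate does. The hyperplane is parametrised by a
  Euclidean space of one dimension less, so dimension one must be excluded: there A3 would ask for a
  negative Hausdorff dimension.\<close>

lemma haus_gauge_empty [simp]: "haus_gauge s {} = 0"
  by (simp add: haus_gauge_def)

lemma hausdorff_outer_delta_le: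
  assumes "A \<subseteq> (\<Union>i. C i)" "\<And>i. bounded (C i)" "\<And>i. diameter (C i) \<le> \<delta>"
  shows "hausdorff_outer_delta s \<delta> A \<le> (\<Sum>i. ennreal (haus_gauge s (C i)))"
  unfolding hausdorff_outer_delta_def by (rule INF_lower) (use assms in auto)

lemma hausdorff_outer_delta_less:
  assumes "hausdorff_outer_delta s \<delta> A < c"
  obtains C :: "nat \<Rightarrow> 'a::metric_space set"
  where "A \<subseteq> (\<Union>i. C i)" "\<And>i. bounded (C i)" "\<And>i. diameter (C i) \<le> \<delta>"
    "(\<Sum>i. ennreal (haus_gauge s (C i))) < c"
  using assms unfolding hausdorff_outer_delta_def INF_less_iff by auto

lemma hausdorff_outer_delta_mono:
  "A \<subseteq> B \<Longrightarrow> hausdorff_outer_delta s \<delta> A \<le> hausdorff_outer_delta s \<delta> B"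
  unfolding hausdorff_outer_delta_def by (rule INF_superset_mono) auto

lemma hausdorff_outer_delta_antimono:
  "\<delta> \<le> \<epsilon> \<Longrightarrow> hausdorff_outer_delta s \<epsilon> A \<le> hausdorff_outer_delta s \<delta> A"
  unfolding hausdorff_outer_delta_def
  by (rule INF_superset_mono) (auto intro: order_trans)

lemma hausdorff_outer_delta_le_outer:
  "\<delta> > 0 \<Longrightarrow> hausdorff_outer_delta s \<delta> A \<le> hausdorff_outer s A"
  unfolding hausdorff_outer_def by (rule SUP_upper) auto

lemma hausdorff_outer_mono: "A \<subseteq> B \<Longrightarrow> hausdorff_outer s A \<le> hausdorff_outer s B"
  unfolding hausdorff_outer_def by (rule SUP_mono) (auto intro: hausdorff_outer_delta_mono)

lemma hausdorff_outer_empty [simp]: "hausdorff_outer s {} = 0"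
proof -
  have "hausdorff_outer_delta s \<delta> ({}::'a set) = 0" if "\<delta> > 0" for \<delta>
    using hausdorff_outer_delta_le[of "{}::'a set" "\<lambda>_. {}" \<delta> s] that by simp
  then show ?thesis unfolding hausdorff_outer_def by simp
qed

text \<open>Covers of the \<open>A n\<close> that are optimal up to e / 2^(n+1) are merged into one
  sequence by the bijection between pairs and natural numbers. The total may be taken finite; then
  every term is finite and near-optimal covers exist.\<close>

lemma hausdorff_outer_delta_UN:
  fixes A :: "nat \<Rightarrow> 'a::metric_space set"
  shows "hausdorff_outer_delta s \<delta> (\<Union>n. A n) \<le> (\<Sum>n. hausdorff_outer_delta s \<delta> (A n))"
proof (rule ennreal_le_epsilon)
  let ?H = "hausdorff_outer_delta s \<delta>"
  fix e :: real assume e: "0 < e" "(\<Sum>n. ?H (A n)) < top"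
  then have *: "?H (A n) < ?H (A n) + e * (1/2)^Suc n" for n
    by (auto simp add: less_top dest!: ennreal_suminf_lessD)
  have "\<exists>C. A n \<subseteq> (\<Union>i. C i) \<and> (\<forall>i. bounded (C i) \<and> diameter (C i) \<le> \<delta>) \<and>
      (\<Sum>i. ennreal (haus_gauge s (C i))) \<le> ?H (A n) + e * (1/2)^Suc n" for n
    using hausdorff_outer_delta_less[OF *[of n]] by (metis order_less_imp_le)
  then obtain C where C: "\<And>n. A n \<subseteq> (\<Union>i. C n i)" "\<And>n i. bounded (C n i)"
      "\<And>n i. diameter (C n i) \<le> \<delta>"
      "\<And>n. (\<Sum>i. ennreal (haus_gauge s (C n i))) \<le> ?H (A n) + e * (1/2)^Suc n"
    by metis
  define D where "D k = case_prod C (prod_decode k)" for k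
  have "?H (\<Union>n. A n) \<le> (\<Sum>k. ennreal (haus_gauge s (D k)))"
  proof (rule hausdorff_outer_delta_le)
    show "(\<Union>n. A n) \<subseteq> (\<Union>k. D k)"
    proof safe
      fix y n assume "y \<in> A n"
      then obtain i where "y \<in> C n i" using C(1) by auto
      then have "y \<in> D (prod_encode (n, i))" by (simp add: D_def)
      then show "y \<in> (\<Union>k. D k)" by blast
    qed
  qed (auto simp: D_def C split: prod.split)
  also have "\<dots> = (\<Sum>n. \<Sum>i. ennreal (haus_gauge s (C n i)))"
    using suminf_ennreal_2dimen[of "\<lambda>n. \<Sum>i. ennreal (haus_gauge s (C n i))" "\<lambda>p. ennreal (haus_gauge s (case_prod C p))"]
    by (simp add: D_def comp_def)
  also have "\<dots> \<le> (\<Sum>n. ?H (A n) + ennreal e * ennreal ((1/2)^Suc n))"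
    using e(1) C(4) by (intro suminf_le allI) (auto simp flip: ennreal_mult)
  also have "\<dots> = (\<Sum>n. ?H (A n)) + (\<Sum>n. ennreal e * ennreal ((1/2)^Suc n))"
    by (rule suminf_add[symmetric]) auto
  also have "(\<Sum>n. ennreal e * ennreal ((1/2)^Suc n)) = ennreal e"
  proof -
    have "(\<Sum>n. ennreal ((1/2)^Suc n)) = ennreal 1"
      by (rule suminf_ennreal_eq[OF _ power_half_series]) simp
    then show ?thesis by (simp only: ennreal_suminf_cmult ennreal_1 mult_1_right)
  qed
  finally show "?H (\<Union>n. A n) \<le> (\<Sum>n. ?H (A n)) + ennreal e" .
qed

lemma hausdorff_outer_UN:
  fixes A :: "nat \<Rightarrow> 'a::metric_space set"
  shows "hausdorff_outer s (\<Union>n. A n) \<le> (\<Sum>n. hausdorff_outer s (A n))"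
  unfolding hausdorff_outer_def[of s "\<Union>n. A n"]
proof (rule SUP_least)
  fix \<delta> :: real assume "\<delta> \<in> {0<..}"
  then have "(\<Sum>n. hausdorff_outer_delta s \<delta> (A n)) \<le> (\<Sum>n. hausdorff_outer s (A n))"
    by (intro suminf_le hausdorff_outer_delta_le_outer) auto
  then show "hausdorff_outer_delta s \<delta> (\<Union>n. A n) \<le> (\<Sum>n. hausdorff_outer s (A n))"
    by (rule order_trans[OF hausdorff_outer_delta_UN])
qed

lemma hausdorff_outer_delta_Un:
  assumes "\<delta> > 0"
  shows "hausdorff_outer_delta s \<delta> (A \<union> B) \<le> hausdorff_outer_delta s \<delta> A + hausdorff_outer_delta s \<delta> B"
proof -
  have e: "hausdorff_outer_delta s \<delta> ({}::'a set) = 0"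
    using hausdorff_outer_delta_le_outer[OF assms, of s "{}::'a set"] by simp
  have "hausdorff_outer_delta s \<delta> (A \<union> B) = hausdorff_outer_delta s \<delta> (\<Union>n. binaryset A B n)"
    by (simp add: UN_binaryset_eq)
  also have "\<dots> \<le> (\<Sum>n. hausdorff_outer_delta s \<delta> (binaryset A B n))"
    by (rule hausdorff_outer_delta_UN)
  also have "\<dots> = hausdorff_outer_delta s \<delta> A + hausdorff_outer_delta s \<delta> B"
    using suminf_binaryset_eq[of "hausdorff_outer_delta s \<delta>" A B] e by (simp add: comp_def)
  finally show ?thesis .
qed

lemma hausdorff_outer_Un: "hausdorff_outer s (A \<union> B) \<le> hausdorff_outer s A + hausdorff_outer s B"
  unfolding hausdorff_outer_def[of s "A \<union> B"]
proof (rule SUP_least)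
  fix \<delta> :: real assume \<delta>: "\<delta> \<in> {0<..}"
  then have "hausdorff_outer_delta s \<delta> (A \<union> B) \<le> hausdorff_outer_delta s \<delta> A + hausdorff_outer_delta s \<delta> B"
    by (auto intro: hausdorff_outer_delta_Un)
  also have "\<dots> \<le> hausdorff_outer s A + hausdorff_outer s B"
    using \<delta> by (intro add_mono hausdorff_outer_delta_le_outer) auto
  finally show "hausdorff_outer_delta s \<delta> (A \<union> B) \<le> hausdorff_outer s A + hausdorff_outer s B" .
qed

section \<open>Additivity on separated sets and Caratheodory's criterion\<close>

lemma hausdorff_outer_metric_additive:
  fixes A B :: "'a::metric_space set"
  assumes r: "r > 0" and sep: "\<And>a b. a \<in> A \<Longrightarrow> b \<in> B \<Longrightarrow> dist a b \<ge> r"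
  shows "hausdorff_outer s A + hausdorff_outer s B \<le> hausdorff_outer s (A \<union> B)"
proof -
  have split: "hausdorff_outer_delta s \<delta> A + hausdorff_outer_delta s \<delta> B
      \<le> hausdorff_outer_delta s \<delta> (A \<union> B)" if \<delta>: "\<delta> < r" for \<delta>
    unfolding hausdorff_outer_delta_def[of s \<delta> "A \<union> B"]
  proof (rule INF_greatest)
    fix C :: "nat \<Rightarrow> 'a set"
    assume "C \<in> {C. A \<union> B \<subseteq> (\<Union>i. C i) \<and> (\<forall>i. bounded (C i) \<and> diameter (C i) \<le> \<delta>)}"
    then have C: "A \<union> B \<subseteq> (\<Union>i. C i)" "\<And>i. bounded (C i)" "\<And>i. diameter (C i) \<le> \<delta>"
      by auto
    \<comment> \<open>A set of diameter below r cannot meet both A and B, so the cover splits into a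
      cover of A and one of B without counting any set twice.\<close>
    define P where "P i = (if C i \<inter> A = {} then {} else C i)" for i
    define Q where "Q i = (if C i \<inter> B = {} then {} else C i)" for i
    have AB: "A \<subseteq> (\<Union>i. P i)" "B \<subseteq> (\<Union>i. Q i)"
      using C(1) unfolding P_def Q_def by fastforce+
    \<comment> \<open>No sign of \<open>\<delta>\<close> is assumed; it is nonnegative because a
      cover of mesh \<open>\<delta>\<close> exists, and so {} is an admissible replacement for the
      discarded sets.\<close>
    have d: "diameter ({}::'a set) \<le> \<delta>"
      using C(3)[of 0] diameter_ge_0[OF C(2)[of 0]] by simp
    have meet: "C i \<inter> A = {} \<or> C i \<inter> B = {}" for i
    proof (rule ccontr)
      assume "\<not> ?thesis"
      then obtain a b where ab: "a \<in> C i" "a \<in> A" "b \<in> C i" "b \<in> B" by auto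
      have "dist a b \<le> diameter (C i)"
        using ab C(2) by (intro diameter_bounded_bound) auto
      then show False using sep[of a b] ab C(3)[of i] \<delta> by auto
    qed
    have g: "ennreal (haus_gauge s (P i)) + ennreal (haus_gauge s (Q i)) \<le> ennreal (haus_gauge s (C i))" for i
      using meet[of i] by (auto simp: P_def Q_def)
    have "hausdorff_outer_delta s \<delta> A + hausdorff_outer_delta s \<delta> B
        \<le> (\<Sum>i. ennreal (haus_gauge s (P i))) + (\<Sum>i. ennreal (haus_gauge s (Q i)))"
      using C d by (intro add_mono hausdorff_outer_delta_le AB) (auto simp: P_def Q_def)
    also have "\<dots> = (\<Sum>i. ennreal (haus_gauge s (P i)) + ennreal (haus_gauge s (Q i)))"
      by (rule suminf_add) auto
    also have "\<dots> \<le> (\<Sum>i. ennreal (haus_gauge s (C i)))"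
      by (intro suminf_le g) auto
    finally show "hausdorff_outer_delta s \<delta> A + hausdorff_outer_delta s \<delta> B
      \<le> (\<Sum>i. ennreal (haus_gauge s (C i)))" .
  qed
  \<comment> \<open>The two suprema run over independent scales. A common smaller scale below r
    serves both, as the covering value grows when the scale shrinks.\<close>
  have le: "hausdorff_outer_delta s d A + hausdorff_outer_delta s e B \<le> hausdorff_outer s (A \<union> B)"
    if "d > 0" "e > 0" for d e
  proof -
    define \<delta> where "\<delta> = min (min d e) (r / 2)"
    have "\<delta> > 0" "\<delta> < r" "\<delta> \<le> d" "\<delta> \<le> e" using that r by (auto simp: \<delta>_def)
    then show ?thesis
      by (meson add_mono hausdorff_outer_delta_antimono hausdorff_outer_delta_le_outer split order_trans)
  qed
  have le2: "hausdorff_outer s A + hausdorff_outer_delta s e B \<le> hausdorff_outer s (A \<union> B)" if "e > 0" for e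
    unfolding hausdorff_outer_def[of s A]
    using le[OF _ that] by (subst ennreal_SUP_add_left[symmetric]) (auto intro!: SUP_least)
  show ?thesis
    unfolding hausdorff_outer_def[of s B] add.commute[of "hausdorff_outer s A"]
    using le2 by (subst ennreal_SUP_add_left[symmetric]) (auto intro!: SUP_least simp: add.commute)
qed

lemma hausdorff_outer_metric_additive_finite:
  fixes S :: "nat \<Rightarrow> 'a::metric_space set"
  assumes "\<And>m. \<exists>r>0. \<forall>k<m. \<forall>a\<in>S k. \<forall>b\<in>S m. r \<le> dist a b"
  shows "(\<Sum>k<m. hausdorff_outer s (S k)) \<le> hausdorff_outer s (\<Union>k<m. S k)"
proof (induction m)
  case (Suc m)
  obtain r where r: "r > 0" "\<forall>k<m. \<forall>a\<in>S k. \<forall>b\<in>S m. r \<le> dist a b"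
    using assms by blast
  have "(\<Sum>k<Suc m. hausdorff_outer s (S k)) \<le> hausdorff_outer s (\<Union>k<m. S k) + hausdorff_outer s (S m)"
    using Suc by (simp add: add_right_mono)
  also have "\<dots> \<le> hausdorff_outer s ((\<Union>k<m. S k) \<union> S m)"
    by (rule hausdorff_outer_metric_additive[OF r(1)]) (use r(2) in auto)
  also have "(\<Union>k<m. S k) \<union> S m = (\<Union>k<Suc m. S k)"
    by (auto simp: less_Suc_eq)
  finally show ?case .
qed simp

text \<open>Points of T at distance at least 1 / (n+1) from F are separated from T \<inter> F, so
  additivity holds for \<open>A n\<close>. What remains of T - F is the union of the shells
  \<open>S k\<close> with k \<ge> n. Shells of equal parity are pairwise separated, which bounds the
  sum of all shells by twice the value of T; the tail therefore tends to 0.\<close>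

lemma hausdorff_outer_closed_split:
  fixes F T :: "'a::metric_space set"
  assumes F: "closed F" "F \<noteq> {}"
  shows "hausdorff_outer s (T \<inter> F) + hausdorff_outer s (T - F) \<le> hausdorff_outer s T"
proof (cases "hausdorff_outer s T = top")
  case False
  define q where "q n = 1 / real (Suc n)" for n
  have q: "q n > 0" "q (Suc n) < q n" for n by (auto simp: q_def field_simps)
  have q_mono: "m \<le> n \<Longrightarrow> q n \<le> q m" for m n by (auto simp: q_def field_simps)
  define A where "A n = {y \<in> T. q n \<le> infdist y F}" for n
  define S where "S n = {y \<in> T. q (Suc n) \<le> infdist y F \<and> infdist y F < q n}" for n
  \<comment> \<open>c = 0 and c = 1 give the two parities. Neighbouring shells may touch, but
    between two shells of equal parity there is a whole shell of positive thickness.\<close>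
  have S_sum: "(\<Sum>k<m. hausdorff_outer s (S (2 * k + c))) \<le> hausdorff_outer s T" for m c
  proof -
    have "\<exists>r>0. \<forall>k<m. \<forall>a\<in>S (2 * k + c). \<forall>b\<in>S (2 * m + c). r \<le> dist a b" for m
    proof (cases m)
      case 0
      then show ?thesis by (auto intro: exI[of _ 1])
    next
      case (Suc m')
      have "\<forall>k<m. \<forall>a\<in>S (2 * k + c). \<forall>b\<in>S (2 * m + c). q (2 * m + c - 1) - q (2 * m + c) \<le> dist a b"
      proof (intro allI impI ballI)
      fix k a b assume "k < m" and ab: "a \<in> S (2 * k + c)" "b \<in> S (2 * m + c)"
      then have "q (2 * m + c - 1) \<le> q (Suc (2 * k + c))" by (intro q_mono) auto
      then have "q (2 * m + c - 1) \<le> infdist a F" using ab by (auto simp: S_def)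
      moreover have "infdist b F < q (2 * m + c)" using ab by (auto simp: S_def)
      moreover have "infdist a F \<le> infdist b F + dist a b" by (rule infdist_triangle)
      ultimately show "q (2 * m + c - 1) - q (2 * m + c) \<le> dist a b" by linarith
      qed
      moreover have "0 < q (2 * m + c - 1) - q (2 * m + c)"
        using q(2)[of "2 * m + c - 1"] Suc by simp
      ultimately show ?thesis by blast
    qed
    then have "(\<Sum>k<m. hausdorff_outer s (S (2 * k + c))) \<le> hausdorff_outer s (\<Union>k<m. S (2 * k + c))"
      by (rule hausdorff_outer_metric_additive_finite)
    also have "\<dots> \<le> hausdorff_outer s T"
      by (rule hausdorff_outer_mono) (auto simp: S_def)
    finally show ?thesis .
  qed
  define X where "X = (\<Sum>k. hausdorff_outer s (S k))"
  have S_sum2: "(\<Sum>k<2 * m. hausdorff_outer s (S k)) =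
      (\<Sum>k<m. hausdorff_outer s (S (2 * k + 0))) + (\<Sum>k<m. hausdorff_outer s (S (2 * k + 1)))" for m
    by (induction m) (auto simp: ac_simps)
  have "(\<Sum>k<m. hausdorff_outer s (S k)) \<le> hausdorff_outer s T + hausdorff_outer s T" for m
  proof -
    have "(\<Sum>k<m. hausdorff_outer s (S k)) \<le> (\<Sum>k<2 * m. hausdorff_outer s (S k))"
      by (rule sum_mono2) auto
    also have "\<dots> \<le> hausdorff_outer s T + hausdorff_outer s T"
      unfolding S_sum2 by (intro add_mono S_sum)
    finally show ?thesis .
  qed
  then have "X \<le> hausdorff_outer s T + hausdorff_outer s T"
    unfolding X_def by (intro suminf_le_const) auto
  then have X: "X < top" using False
    by (metis ennreal_add_eq_top less_top top.extremum_uniqueI)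
  have "(\<Sum>k. hausdorff_outer s (S (k + n))) + (\<Sum>k<n. hausdorff_outer s (S k)) = X" for n
    unfolding X_def by (rule suminf_offset[symmetric]) auto
  note tail = this
  have bound: "hausdorff_outer s (T \<inter> F) + hausdorff_outer s (T - F)
      \<le> hausdorff_outer s T + (\<Sum>k. hausdorff_outer s (S (k + n)))" for n
  proof -
    have "T - F \<subseteq> A n \<union> (\<Union>k. S (k + n))"
    proof
      fix y assume y: "y \<in> T - F"
      have pos: "infdist y F > 0"
        using y F by (metis DiffD2 in_closed_iff_infdist_zero infdist_nonneg order_less_le)
      show "y \<in> A n \<union> (\<Union>k. S (k + n))"
      proof (cases "q n \<le> infdist y F")
        case False
        obtain m where "q m < infdist y F"
          using reals_Archimedean[OF pos] by (auto simp: q_def inverse_eq_divide)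
        then have ex: "\<exists>m. q m \<le> infdist y F" by (auto intro: less_imp_le)
        \<comment> \<open>Closedness of F makes the distance positive, so the least such l exists.
          Minimality gives q l \<le> infdist < q (l - 1), which is membership in shell l -
          1.\<close>
        define l where "l = (LEAST m. q m \<le> infdist y F)"
        have l: "q l \<le> infdist y F" unfolding l_def by (rule LeastI_ex[OF ex])
        have "n < l" using l False q_mono[of l n] by (meson linorder_not_le order_trans)
        moreover have "\<not> q (l - 1) \<le> infdist y F"
          using not_less_Least[of "l - 1" "\<lambda>m. q m \<le> infdist y F"] \<open>n < l\<close> by (simp add: l_def)
        ultimately have "y \<in> S (l - 1 - n + n)" using l y by (simp add: S_def)
        then show ?thesis by blast
      qed (use y in \<open>auto simp: A_def\<close>)
    qed
    then have "hausdorff_outer s (T - F) \<le> hausdorff_outer s (A n \<union> (\<Union>k. S (k + n)))"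
      by (rule hausdorff_outer_mono)
    also have "\<dots> \<le> hausdorff_outer s (A n) + (\<Sum>k. hausdorff_outer s (S (k + n)))"
      by (rule order_trans[OF hausdorff_outer_Un add_left_mono[OF hausdorff_outer_UN]])
    finally have "hausdorff_outer s (T \<inter> F) + hausdorff_outer s (T - F)
       \<le> (hausdorff_outer s (T \<inter> F) + hausdorff_outer s (A n)) + (\<Sum>k. hausdorff_outer s (S (k + n)))"
      by (simp add: add_left_mono add.assoc)
    also have "hausdorff_outer s (T \<inter> F) + hausdorff_outer s (A n) \<le> hausdorff_outer s (T \<inter> F \<union> A n)"
    proof (rule hausdorff_outer_metric_additive[OF q(1)[of n]])
      fix a b assume "a \<in> T \<inter> F" "b \<in> A n"
      then show "q n \<le> dist a b"
        using infdist_le[of a F b] by (auto simp: A_def dist_commute)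
    qed
    also have "\<dots> \<le> hausdorff_outer s T"
      by (rule hausdorff_outer_mono) (auto simp: A_def)
    finally show ?thesis by (simp add: add_right_mono)
  qed
  show ?thesis
  proof (rule ennreal_le_epsilon)
    fix e :: real assume e: "0 < e"
    have "(\<lambda>n. \<Sum>k<n. hausdorff_outer s (S k)) \<longlonglongrightarrow> X"
      unfolding X_def by (rule summable_LIMSEQ) auto
    then have "(\<lambda>n. (\<Sum>k<n. hausdorff_outer s (S k)) + ennreal e) \<longlonglongrightarrow> X + ennreal e"
      by (intro tendsto_add tendsto_const)
    moreover have "X < X + ennreal e" using X e by simp
    ultimately have "eventually (\<lambda>n. X < (\<Sum>k<n. hausdorff_outer s (S k)) + ennreal e) sequentially"
      by (rule order_tendstoD(1))
    then obtain n where n: "X < (\<Sum>k<n. hausdorff_outer s (S k)) + ennreal e"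
      by (auto simp: eventually_sequentially)
    have "(\<Sum>k. hausdorff_outer s (S (k + n))) \<le> ennreal e"
    proof (rule ccontr)
      assume "\<not> ?thesis"
      then have "ennreal e + (\<Sum>k<n. hausdorff_outer s (S k)) \<le> X"
        unfolding tail[of n, symmetric] by (intro add_right_mono) simp
      with n show False by (simp add: add.commute leD)
    qed
    then show "hausdorff_outer s (T \<inter> F) + hausdorff_outer s (T - F) \<le> hausdorff_outer s T + ennreal e"
      by (rule order_trans[OF bound[of n] add_left_mono])
  qed
qed simp

lemma outer_measure_space_hausdorff_outer: "outer_measure_space UNIV (hausdorff_outer s)"
  unfolding outer_measure_space_def positive_def increasing_def countably_subadditive_def
  by (auto intro: hausdorff_outer_mono hausdorff_outer_UN)

text \<open>\<open>measure_of\<close> keeps the given set function only if it is a measure on the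
  generated sigma-algebra, and yields the zero measure otherwise; so countable additivity on Borel
  sets must be known before \<open>hausdorff_measure\<close> says anything. Closed sets generate,
  hence it suffices that they satisfy Caratheodory's condition.\<close>

lemma measure_space_hausdorff_outer:
  "measure_space UNIV (sets borel) (hausdorff_outer s :: 'a::metric_space set \<Rightarrow> ennreal)"
proof -
  interpret P: sigma_algebra UNIV "UNIV :: 'a set set"
    using sigma_algebra_Pow[of "UNIV :: 'a set"] by simp
  let ?L = "lambda_system UNIV UNIV (hausdorff_outer s :: 'a set \<Rightarrow> ennreal)"
  have L: "measure_space UNIV ?L (hausdorff_outer s)"
    by (rule P.caratheodory_lemma[OF outer_measure_space_hausdorff_outer])
  have "F \<in> ?L" if "closed F" for F
  \<comment> \<open>The empty set is separate because \<open>infdist\<close> to it is 0 by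
    convention, so distance shells would be meaningless.\<close>
  proof (cases "F = {}")
    case False
    have "hausdorff_outer s (T \<inter> F) + hausdorff_outer s (T - F) = hausdorff_outer s T" for T
    proof (rule antisym)
      show "hausdorff_outer s T \<le> hausdorff_outer s (T \<inter> F) + hausdorff_outer s (T - F)"
        using hausdorff_outer_Un[of s "T \<inter> F" "T - F"] by (simp add: Un_Diff_Int Un_commute)
    qed (rule hausdorff_outer_closed_split[OF that False])
    then show ?thesis by (simp add: P.lambda_system_eq)
  qed (simp add: P.lambda_system_eq)
  then have "sigma_sets UNIV (Collect closed) \<subseteq> ?L"
    using L by (intro sigma_algebra.sigma_sets_subset) (auto simp: measure_space_def)
  then have sub: "sets (borel :: 'a measure) \<subseteq> ?L"
    by (simp add: borel_eq_closed)
  have ca: "countably_additive ?L (hausdorff_outer s :: 'a set \<Rightarrow> ennreal)"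
    using L by (simp only: measure_space_def)
  have "countably_additive (sets borel) (hausdorff_outer s :: 'a set \<Rightarrow> ennreal)"
    unfolding countably_additive_def
  proof (intro allI impI)
    fix A :: "nat \<Rightarrow> 'a set"
    assume "range A \<subseteq> sets borel" "disjoint_family A" "\<Union> (range A) \<in> sets borel"
    moreover from this sub have "range A \<subseteq> ?L" "\<Union> (range A) \<in> ?L" by blast+
    ultimately show "(\<Sum>i. hausdorff_outer s (A i)) = hausdorff_outer s (\<Union> (range A))"
      using ca unfolding countably_additive_def by simp
  qed
  with sets.sigma_algebra_axioms[of "borel :: 'a measure"] show ?thesis
    unfolding measure_space_def positive_def by simp
qed

lemma space_hausdorff_measure [simp]: "space (hausdorff_measure s) = UNIV"
  unfolding hausdorff_measure_def by (rule space_measure_of) simp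

lemma sets_hausdorff_measure [simp, measurable_cong]: "sets (hausdorff_measure s) = sets borel"
  unfolding hausdorff_measure_def
  using sets.sets_measure_of_eq[of "borel :: 'a measure"] by (simp only: space_borel)

lemma emeasure_hausdorff_measure:
  "A \<in> sets borel \<Longrightarrow> emeasure (hausdorff_measure s) A = hausdorff_outer s A"
  using measure_space_hausdorff_outer[of s]
  unfolding hausdorff_measure_def measure_space_def
  by (subst emeasure_measure_of_sigma) auto

section \<open>The isodiametric inequality\<close>

text \<open>Indexed by all points of the space instead of those of the hyperplane orthogonal to e:
  the value is constant along e, and no product decomposition is needed.\<close>

definition line_length :: "'a::euclidean_space \<Rightarrow> 'a set \<Rightarrow> 'a \<Rightarrow> ennreal" where
  "line_length e A y = emeasure lborel {s::real. y + s *\<^sub>R e \<in> A}"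

text \<open>Steiner symmetrization for a unit vector e: on every line parallel to e the set is
  replaced by the open interval of the same length centred on the hyperplane orthogonal to e. The
  strict inequality leaves out lines that meet the set in measure 0.\<close>

definition steiner :: "'a::euclidean_space \<Rightarrow> 'a set \<Rightarrow> 'a set" where
  "steiner e A = {y. ennreal (2 * \<bar>y \<bullet> e\<bar>) < line_length e A y}"

lemma measurable_line_length [measurable]:
  assumes A: "A \<in> sets borel"
  shows "line_length e A \<in> borel_measurable borel"
proof -
  have "(\<lambda>p. fst p + snd p *\<^sub>R e) \<in> borel \<Otimes>\<^sub>M borel \<rightarrow>\<^sub>M (borel :: 'a measure)"
    by measurable
  from measurable_sets[OF this A]
  have "{p :: 'a \<times> real. fst p + snd p *\<^sub>R e \<in> A} \<in> sets (borel \<Otimes>\<^sub>M borel)"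
    by (simp add: vimage_def space_pair_measure)
  then have "(\<lambda>y. emeasure lborel (Pair y -` {p :: 'a \<times> real. fst p + snd p *\<^sub>R e \<in> A})) \<in> borel_measurable borel"
    by (intro sigma_finite_measure.measurable_emeasure_Pair sigma_finite_lborel)
       (simp cong: sets_pair_measure_cong)
  then show ?thesis by (simp add: line_length_def[abs_def] vimage_def)
qed

lemma borel_steiner [measurable]:
  assumes [measurable]: "A \<in> sets borel" shows "steiner e A \<in> sets borel"
  unfolding steiner_def by measurable

lemma line_length_shift:
  assumes [measurable]: "A \<in> sets borel"
  shows "line_length e A (y + c *\<^sub>R e) = line_length e A y"
proof -
  have "line_length e A y = emeasure (distr lborel borel ((+) c)) {s. y + s *\<^sub>R e \<in> A}"
    by (simp add: line_length_def lborel_distr_plus)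
  also have "\<dots> = line_length e A (y + c *\<^sub>R e)"
    unfolding line_length_def
    by (subst emeasure_distr) (auto simp: vimage_def algebra_simps)
  finally show ?thesis by simp
qed

text \<open>Slicing along \<open>e\<close> without splitting off a factor: integrate the indicator of
  \<open>{(y, s). y + s e \<in> A, 0 \<le> y \<bullet> e < 1}\<close> in both orders.\<close>
lemma emeasure_eq_line_length:
  fixes e :: "'a::euclidean_space"
  assumes A [measurable]: "A \<in> sets borel" and e: "norm e = 1"
  shows "emeasure lborel A = (\<integral>\<^sup>+y. line_length e A y * indicator {y. 0 \<le> y \<bullet> e \<and> y \<bullet> e < 1} y \<partial>lborel)"
proof -
  have ee: "e \<bullet> e = 1" using e by (simp add: dot_square_norm)
  let ?Q = "{y::'a. 0 \<le> y \<bullet> e \<and> y \<bullet> e < 1}"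
  have "(\<integral>\<^sup>+y. line_length e A y * indicator ?Q y \<partial>lborel)
      = (\<integral>\<^sup>+y. (\<integral>\<^sup>+s. indicator A (y + s *\<^sub>R e) * indicator ?Q y \<partial>lborel) \<partial>lborel)"
  proof (rule nn_integral_cong)
    fix y :: 'a
    have "{s. y + s *\<^sub>R e \<in> A} \<in> sets borel" by measurable
    then have "line_length e A y = (\<integral>\<^sup>+s. indicator {s. y + s *\<^sub>R e \<in> A} s \<partial>lborel)"
      by (simp add: line_length_def)
    also have "\<dots> = (\<integral>\<^sup>+s. indicator A (y + s *\<^sub>R e) \<partial>lborel)"
      by (intro nn_integral_cong) (auto simp: indicator_def)
    finally show "line_length e A y * indicator ?Q y = (\<integral>\<^sup>+s. indicator A (y + s *\<^sub>R e) * indicator ?Q y \<partial>lborel)"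
      by (simp add: nn_integral_multc)
  qed
  also have "\<dots> = (\<integral>\<^sup>+s. (\<integral>\<^sup>+y. indicator A (y + s *\<^sub>R e) * indicator ?Q y \<partial>lborel) \<partial>lborel)"
    by (rule lborel_pair.Fubini') measurable
  also have "\<dots> = (\<integral>\<^sup>+s. (\<integral>\<^sup>+y. indicator A y * indicator ?Q (y - s *\<^sub>R e) \<partial>lborel) \<partial>lborel)"
  proof (rule nn_integral_cong)
    fix s :: real
    have "(\<integral>\<^sup>+y. indicator A y * indicator ?Q (y - s *\<^sub>R e) \<partial>lborel)
        = (\<integral>\<^sup>+y. indicator A y * indicator ?Q (y - s *\<^sub>R e) \<partial>distr lborel borel ((+) (s *\<^sub>R e)))"
      by (simp add: lborel_distr_plus)
    also have "\<dots> = (\<integral>\<^sup>+y. indicator A (y + s *\<^sub>R e) * indicator ?Q y \<partial>lborel)"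
      by (subst nn_integral_distr) (auto simp: add.commute)
    finally show "(\<integral>\<^sup>+y. indicator A (y + s *\<^sub>R e) * indicator ?Q y \<partial>lborel) =
      (\<integral>\<^sup>+y. indicator A y * indicator ?Q (y - s *\<^sub>R e) \<partial>lborel)" by simp
  qed
  also have "\<dots> = (\<integral>\<^sup>+y. (\<integral>\<^sup>+s. indicator A y * indicator ?Q (y - s *\<^sub>R e) \<partial>lborel) \<partial>lborel)"
    by (rule lborel_pair.Fubini') measurable
  also have "\<dots> = (\<integral>\<^sup>+y. indicator A y \<partial>lborel)"
  proof (rule nn_integral_cong)
    fix y :: 'a
    \<comment> \<open>The slab has width 1 in direction e, so each y is counted for a set of s of
      length exactly 1.\<close>
    have "(\<integral>\<^sup>+s. indicator ?Q (y - s *\<^sub>R e) \<partial>lborel) = (\<integral>\<^sup>+s. indicator {y \<bullet> e - 1<..y \<bullet> e} s \<partial>lborel)"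
      by (intro nn_integral_cong) (auto simp: indicator_def inner_diff_left ee)
    then show "(\<integral>\<^sup>+s. indicator A y * indicator ?Q (y - s *\<^sub>R e) \<partial>lborel) = indicator A y"
      by (simp add: nn_integral_cmult)
  qed
  finally show ?thesis by simp
qed

text \<open>With c = y \<bullet> e the set is the slice of the symmetrized set along the line
  through y. Infinite m gives the whole line.\<close>

lemma emeasure_lborel_centred_interval:
  "emeasure lborel {s::real. ennreal (2 * \<bar>c + s\<bar>) < m} = m"
proof (cases m)
  case (real r)
  then have "{s. ennreal (2 * \<bar>c + s\<bar>) < m} = {- c - r / 2 <..< - c + r / 2}"
    by (auto simp: ennreal_less_iff abs_if split: if_splits)
  then show ?thesis using real by simp
qed simp

lemma line_length_steiner:
  assumes A: "A \<in> sets borel" and e: "norm e = 1" shows "line_length e (steiner e A) y = line_length e A y"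
proof -
  have "e \<bullet> e = 1" using e by (simp add: dot_square_norm)
  then show ?thesis
    unfolding line_length_def[of e "steiner e A"] unfolding steiner_def
    by (simp add: line_length_shift[OF A] inner_add_left emeasure_lborel_centred_interval)
qed

lemma emeasure_steiner:
  assumes "A \<in> sets borel" "norm e = 1"
  shows "emeasure lborel (steiner e A) = emeasure lborel A"
  using assms by (simp add: emeasure_eq_line_length[of _ e] line_length_steiner borel_steiner)

text \<open>If all differences of parameters were at most 2 t, the slice would lie in the interval
  from Sup - 2 t to Sup. The slice itself need be neither an interval nor closed.\<close>

lemma line_length_longD:
  assumes "ennreal (2 * t) < line_length e A y" "t \<ge> 0"
  obtains a b where "y + a *\<^sub>R e \<in> A" "y + b *\<^sub>R e \<in> A" "2 * t < b - a"
proof (rule ccontr)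
  note * = that
  assume no: "\<not> thesis"
  let ?S = "{s. y + s *\<^sub>R e \<in> A}"
  have le: "b - a \<le> 2 * t" if "a \<in> ?S" "b \<in> ?S" for a b
    using *[of a b] no that by force
  have "?S \<noteq> {}"
  proof
    assume "?S = {}"
    then have "line_length e A y = 0" unfolding line_length_def by (simp only: emeasure_empty)
    then show False using assms(1) by simp
  qed
  then obtain s0 where s0: "s0 \<in> ?S" by auto
  have bd: "bdd_above ?S"
  proof (rule bdd_aboveI)
    fix x assume "x \<in> ?S"
    from le[OF s0 this] show "x \<le> s0 + 2 * t" by simp
  qed
  have "?S \<subseteq> {Sup ?S - 2 * t .. Sup ?S}"
  proof
    fix s assume s: "s \<in> ?S"
    have "Sup ?S \<le> s + 2 * t"
    proof (rule cSup_least)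
      fix x assume "x \<in> ?S"
      from le[OF s this] show "x \<le> s + 2 * t" by simp
    qed (use s in blast)
    then show "s \<in> {Sup ?S - 2 * t .. Sup ?S}" using cSup_upper[OF s bd] by simp
  qed
  then have "line_length e A y \<le> emeasure lborel {Sup ?S - 2 * t .. Sup ?S}"
    unfolding line_length_def by (rule emeasure_mono) simp
  then show False using assms by (simp add: leD)
qed

text \<open>Symmetrization does not increase the diameter. The components orthogonal to e are kept,
  so by Pythagoras it suffices to find points of A on the same two lines whose heights differ by at
  least as much.\<close>

lemma dist_steiner:
  fixes A :: "'a::euclidean_space set"
  assumes A: "A \<in> sets borel"
    and D: "\<And>a b. a \<in> A \<Longrightarrow> b \<in> A \<Longrightarrow> dist a b \<le> D" and e: "norm e = 1"
    and yz: "y \<in> steiner e A" "z \<in> steiner e A"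
  shows "dist y z \<le> D"
proof -
  have ee: "e \<bullet> e = 1" using e by (simp add: dot_square_norm)
  define y' where "y' = y - (y \<bullet> e) *\<^sub>R e"
  define z' where "z' = z - (z \<bullet> e) *\<^sub>R e"
  have orth: "(y' - z') \<bullet> e = 0" by (simp add: y'_def z'_def inner_diff_left ee)
  have nrm: "(norm ((y' + a *\<^sub>R e) - (z' + b *\<^sub>R e)))\<^sup>2 = (norm (y' - z'))\<^sup>2 + (a - b)\<^sup>2" for a b
  proof -
    have "(y' + a *\<^sub>R e) - (z' + b *\<^sub>R e) = (y' - z') + (a - b) *\<^sub>R e" by (simp add: algebra_simps)
    moreover have "e \<bullet> (y' - z') = 0" using orth by (simp only: inner_commute)
    ultimately show ?thesis using orth
      by (simp only: power2_norm_eq_inner inner_add_left inner_add_right inner_scaleR_left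
          inner_scaleR_right ee) (simp add: power2_eq_square)
  qed
  have ll: "line_length e A y' = line_length e A y" "line_length e A z' = line_length e A z"
    using line_length_shift[OF A, of e y "- (y \<bullet> e)"] line_length_shift[OF A, of e z "- (z \<bullet> e)"]
    by (simp_all add: y'_def z'_def)
  obtain a b where ab: "y' + a *\<^sub>R e \<in> A" "y' + b *\<^sub>R e \<in> A" "2 * \<bar>y \<bullet> e\<bar> < b - a"
    using line_length_longD[of "\<bar>y \<bullet> e\<bar>" e A y'] yz by (auto simp: steiner_def ll)
  obtain c d where cd: "z' + c *\<^sub>R e \<in> A" "z' + d *\<^sub>R e \<in> A" "2 * \<bar>z \<bullet> e\<bar> < d - c"
    using line_length_longD[of "\<bar>z \<bullet> e\<bar>" e A z'] yz by (auto simp: steiner_def ll)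
  \<comment> \<open>One of the two crossed pairs (b, c), (a, d) works: (b - c) + (d - a) = (b - a) +
    (d - c) exceeds 2 |y \<bullet> e| + 2 |z \<bullet> e|, which is at least 2 |y \<bullet> e - z
    \<bullet> e|.\<close>
  have "\<exists>s t. y' + s *\<^sub>R e \<in> A \<and> z' + t *\<^sub>R e \<in> A \<and> \<bar>y \<bullet> e - z \<bullet> e\<bar> \<le> \<bar>s - t\<bar>"
  proof (cases "\<bar>y \<bullet> e - z \<bullet> e\<bar> \<le> \<bar>b - c\<bar>")
    case False
    then have "\<bar>y \<bullet> e - z \<bullet> e\<bar> \<le> \<bar>a - d\<bar>" using ab(3) cd(3) by linarith
    then show ?thesis using ab cd by blast
  qed (use ab cd in blast)
  then obtain s t where st: "y' + s *\<^sub>R e \<in> A" "z' + t *\<^sub>R e \<in> A" "\<bar>y \<bullet> e - z \<bullet> e\<bar> \<le> \<bar>s - t\<bar>" by blast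
  have "y' + (y \<bullet> e) *\<^sub>R e = y" "z' + (z \<bullet> e) *\<^sub>R e = z" by (simp_all add: y'_def z'_def)
  then have "(dist y z)\<^sup>2 = (norm (y' - z'))\<^sup>2 + (y \<bullet> e - z \<bullet> e)\<^sup>2"
    using nrm[of "y \<bullet> e" "z \<bullet> e"] by (simp add: dist_norm)
  also have "\<dots> \<le> (norm (y' - z'))\<^sup>2 + (s - t)\<^sup>2"
    using st(3) by (simp add: abs_le_square_iff)
  also have "\<dots> = (dist (y' + s *\<^sub>R e) (z' + t *\<^sub>R e))\<^sup>2" by (simp only: nrm dist_norm)
  finally have "(dist y z)\<^sup>2 \<le> (dist (y' + s *\<^sub>R e) (z' + t *\<^sub>R e))\<^sup>2" .
  then have "dist y z \<le> dist (y' + s *\<^sub>R e) (z' + t *\<^sub>R e)" by (rule power2_le_imp_le) simp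
  also have "\<dots> \<le> D" by (rule D) (use st in auto)
  finally show ?thesis .
qed

section \<open>Central symmetry from successive symmetrizations\<close>

definition axis_reflect :: "'a::euclidean_space \<Rightarrow> 'a \<Rightarrow> 'a" where
  "axis_reflect e y = y - (2 * (y \<bullet> e)) *\<^sub>R e"

lemma axis_reflect_steiner_self:
  assumes A: "A \<in> sets borel" and e: "norm e = 1" and y: "y \<in> steiner e A"
  shows "axis_reflect e y \<in> steiner e A"
proof -
  have "e \<bullet> e = 1" using e by (simp add: dot_square_norm)
  then show ?thesis using y line_length_shift[OF A, of e y "- 2 * (y \<bullet> e)"]
    by (simp add: steiner_def axis_reflect_def inner_diff_left)
qed

text \<open>The reflection in f carries the slice through y to the slice through the reflected
  point, and f orthogonal to e leaves the height unchanged. So a symmetry already gained survives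
  symmetrization in an orthogonal direction.\<close>

lemma axis_reflect_steiner_other:
  assumes f: "norm f = 1" and fe: "f \<bullet> e = 0" and A: "\<And>y. y \<in> A \<Longrightarrow> axis_reflect f y \<in> A"
    and y: "y \<in> steiner e A"
  shows "axis_reflect f y \<in> steiner e A"
proof -
  have inv: "axis_reflect f (axis_reflect f y) = y" for y
    using f by (simp add: axis_reflect_def inner_diff_left dot_square_norm)
  have m: "axis_reflect f (y + s *\<^sub>R e) = axis_reflect f y + s *\<^sub>R e" for s
    using fe by (simp add: axis_reflect_def inner_add_left inner_commute[of e])
  have "{s. axis_reflect f y + s *\<^sub>R e \<in> A} = {s. y + s *\<^sub>R e \<in> A}"
    unfolding m[symmetric] using A inv by metis
  moreover have "axis_reflect f y \<bullet> e = y \<bullet> e" using fe by (simp add: axis_reflect_def inner_diff_left)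
  ultimately show ?thesis using y by (simp add: steiner_def line_length_def)
qed

lemma steiner_symmetrization:
  fixes A :: "'a::euclidean_space set"
  assumes A: "A \<in> sets borel" and D: "\<And>a b. a \<in> A \<Longrightarrow> b \<in> A \<Longrightarrow> dist a b \<le> D"
    and B: "B \<subseteq> Basis"
  shows "\<exists>S\<in>sets (borel :: 'a measure). emeasure lborel S = emeasure lborel A \<and>
     (\<forall>a\<in>S. \<forall>b\<in>S. dist a b \<le> D) \<and> (\<forall>e\<in>B. \<forall>y\<in>S. axis_reflect e y \<in> S)"
  using finite_subset[OF B finite_Basis] B
proof (induction B rule: finite_induct)
  case empty
  show ?case by (rule bexI[of _ A]) (use A D in auto)
next
  case (insert e B)
  then obtain S where S: "S \<in> sets borel" "emeasure lborel S = emeasure lborel A"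
     "\<forall>a\<in>S. \<forall>b\<in>S. dist a b \<le> D" "\<forall>e\<in>B. \<forall>y\<in>S. axis_reflect e y \<in> S" by auto
  have e: "norm e = 1" "e \<in> Basis" using insert by auto
  show ?case
  proof (intro bexI[of _ "steiner e S"] conjI ballI)
    show "steiner e S \<in> sets borel" by (rule borel_steiner[OF S(1)])
    show "emeasure lborel (steiner e S) = emeasure lborel A"
      using emeasure_steiner[OF S(1) e(1)] S(2) by simp
    show "dist a b \<le> D" if "a \<in> steiner e S" "b \<in> steiner e S" for a b
      using dist_steiner[OF S(1) _ e(1) that] S(3) by blast
    fix f y assume f: "f \<in> insert e B" and y: "y \<in> steiner e S"
    show "axis_reflect f y \<in> steiner e S"
    proof (cases "f = e")
      case False
      then have f: "f \<in> B" using f by simp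
      have fB: "f \<in> Basis" using f insert.prems by blast
      show ?thesis
      proof (rule axis_reflect_steiner_other[OF _ _ _ y])
        show "norm f = 1" using fB by simp
        show "f \<bullet> e = 0" using fB e(2) False by (simp add: inner_not_same_Basis)
        show "axis_reflect f z \<in> S" if "z \<in> S" for z using S(4) f that by blast
      qed
    next
      case True
      show ?thesis unfolding True by (rule axis_reflect_steiner_self[OF S(1) e(1) y])
    qed
  qed
qed

text \<open>The composition of the reflections in all coordinate hyperplanes is - id; each of them
  leaves the coordinates not yet treated unchanged.\<close>

lemma uminus_mem_of_reflections:
  fixes y :: "'a::euclidean_space"
  assumes S: "\<And>e y. e \<in> Basis \<Longrightarrow> y \<in> S \<Longrightarrow> axis_reflect e y \<in> S" and y: "y \<in> S"
  shows "- y \<in> S"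
proof -
  have "y - (\<Sum>e\<in>B. (2 * (y \<bullet> e)) *\<^sub>R e) \<in> S" if "B \<subseteq> Basis" for B
    using finite_subset[OF that finite_Basis] that
  proof (induction B rule: finite_induct)
    case (insert f B)
    define z where "z = y - (\<Sum>e\<in>B. (2 * (y \<bullet> e)) *\<^sub>R e)"
    have "(\<Sum>e\<in>B. (2 * (y \<bullet> e)) *\<^sub>R e) \<bullet> f = (\<Sum>e\<in>B. 0)"
      unfolding inner_sum_left
    proof (rule sum.cong)
      fix e assume "e \<in> B"
      then have "e \<in> Basis" "e \<noteq> f" using insert by auto
      then show "((2 * (y \<bullet> e)) *\<^sub>R e) \<bullet> f = 0" using insert by (simp add: inner_not_same_Basis)
    qed simp
    then have "z \<bullet> f = y \<bullet> f" by (simp add: z_def inner_diff_left)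
    moreover have "axis_reflect f z \<in> S" using insert by (intro S) (auto simp: z_def)
    ultimately show ?case using insert by (simp add: axis_reflect_def z_def algebra_simps)
  qed (use y in simp)
  from this[of Basis] have "y - 2 *\<^sub>R (\<Sum>e\<in>Basis. (y \<bullet> e) *\<^sub>R e) \<in> S"
    by (simp add: scaleR_sum_right)
  then show ?thesis by (simp add: euclidean_representation scaleR_2)
qed

text \<open>After symmetrization in all coordinate directions the set contains - y with y. Then 2
  |y| = dist y (- y) is at most the diameter, so the set lies in a ball of half the diameter, with
  its volume unchanged.\<close>

theorem isodiametric:
  fixes A :: "'a::euclidean_space set"
  assumes A: "A \<in> sets borel" "A \<noteq> {}" "bounded A"
  shows "emeasure lborel A \<le> ennreal (unit_ball_vol (real DIM('a)) * (diameter A / 2) ^ DIM('a))"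
proof -
  let ?D = "diameter A"
  obtain S :: "'a set" where S: "S \<in> sets borel" "emeasure lborel S = emeasure lborel A"
    "\<forall>a\<in>S. \<forall>b\<in>S. dist a b \<le> ?D" "\<forall>e\<in>Basis. \<forall>y\<in>S. axis_reflect e y \<in> S"
    using steiner_symmetrization[OF A(1), of ?D Basis] diameter_bounded_bound[OF A(3)] by auto
  have "S \<subseteq> cball 0 (?D / 2)"
  proof
    fix y assume y: "y \<in> S"
    then have "- y \<in> S" using S(4) by (intro uminus_mem_of_reflections) auto
    then have "dist y (- y) \<le> ?D" using S(3) y by auto
    moreover have "dist y (- y) = 2 * norm y" by (simp add: dist_norm flip: scaleR_2)
    ultimately show "y \<in> cball 0 (?D / 2)" by simp
  qed
  then have "emeasure lborel S \<le> emeasure lborel (cball (0::'a) (?D / 2))"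
    by (rule emeasure_mono) simp
  also have "\<dots> = ennreal (unit_ball_vol (real DIM('a)) * (?D / 2) ^ DIM('a))"
    using diameter_ge_0[OF A(3)] by (simp add: emeasure_cball)
  finally show ?thesis using S(2) by simp
qed

section \<open>Hausdorff measure of full dimension\<close>

lemma haus_gauge_DIM:
  fixes C :: "'a::euclidean_space set"
  assumes "bounded C" "C \<noteq> {}"
  shows "haus_gauge (real DIM('a)) C = unit_ball_vol (real DIM('a)) * (diameter C / 2) ^ DIM('a)"
  using diameter_ge_0[OF assms(1)] assms(2)
  by (cases "diameter C = 0") (auto simp: haus_gauge_def powr_realpow)

text \<open>Covering sets are arbitrary and may fail to be measurable; the closure is Borel and has
  the same diameter.\<close>

lemma emeasure_lborel_closure_le_gauge:
  fixes C :: "'a::euclidean_space set"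
  assumes "bounded C"
  shows "emeasure lborel (closure C) \<le> ennreal (haus_gauge (real DIM('a)) C)"
proof (cases "C = {}")
  case False
  then show ?thesis
    using isodiametric[of "closure C"] assms bounded_closure[OF assms]
    by (simp add: haus_gauge_DIM diameter_closure)
qed simp

lemma emeasure_lborel_cover_le:
  fixes C :: "nat \<Rightarrow> 'a::euclidean_space set"
  assumes "\<And>i. bounded (C i)"
  shows "emeasure lborel (\<Union>i. closure (C i)) \<le> (\<Sum>i. ennreal (haus_gauge (real DIM('a)) (C i)))"
proof -
  have "emeasure lborel (\<Union>i. closure (C i)) \<le> (\<Sum>i. emeasure lborel (closure (C i)))"
    by (rule emeasure_subadditive_countably) auto
  also have "\<dots> \<le> (\<Sum>i. ennreal (haus_gauge (real DIM('a)) (C i)))"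
    by (intro suminf_le emeasure_lborel_closure_le_gauge assms) auto
  finally show ?thesis .
qed

lemma emeasure_lborel_le_hausdorff_outer:
  fixes A :: "'a::euclidean_space set"
  assumes "A \<in> sets borel"
  shows "emeasure lborel A \<le> hausdorff_outer (real DIM('a)) A"
proof -
  \<comment> \<open>Scale 1 is enough, since the isodiametric bound holds for covering sets of every
    size.\<close>
  have "emeasure lborel A \<le> hausdorff_outer_delta (real DIM('a)) 1 A"
    unfolding hausdorff_outer_delta_def
  proof (rule INF_greatest, clarsimp)
    fix C :: "nat \<Rightarrow> 'a set" assume C: "A \<subseteq> (\<Union>i. C i)" "\<forall>i. bounded (C i) \<and> diameter (C i) \<le> 1"
    have "A \<subseteq> (\<Union>i. closure (C i))" using C(1) closure_subset by blast
    then have "emeasure lborel A \<le> emeasure lborel (\<Union>i. closure (C i))"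
      by (rule emeasure_mono) auto
    also have "\<dots> \<le> (\<Sum>i. ennreal (haus_gauge (real DIM('a)) (C i)))"
      by (rule emeasure_lborel_cover_le) (use C in auto)
    finally show "emeasure lborel A \<le> (\<Sum>i. ennreal (haus_gauge (real DIM('a)) (C i)))" .
  qed
  also have "\<dots> \<le> hausdorff_outer (real DIM('a)) A"
    by (rule hausdorff_outer_delta_le_outer) simp
  finally show ?thesis .
qed

text \<open>A is not assumed measurable, as it will be a set of discontinuities. A Borel null
  superset is the intersection over m of the closures of covers with total gauge below 1 /
  (m+1).\<close>

lemma hausdorff_outer_zero_null_sets:
  fixes A :: "'a::euclidean_space set"
  assumes "hausdorff_outer (real DIM('a)) A = 0"
  obtains N where "N \<in> null_sets lborel" "A \<subseteq> N"
proof -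
  have "hausdorff_outer_delta (real DIM('a)) 1 A < ennreal (1 / real (Suc m))" for m
    using hausdorff_outer_delta_le_outer[of 1 "real DIM('a)" A] assms by simp
  then have "\<exists>C. A \<subseteq> (\<Union>i. C i) \<and> (\<forall>i. bounded (C i)) \<and>
      (\<Sum>i. ennreal (haus_gauge (real DIM('a)) (C i))) < ennreal (1 / real (Suc m))" for m
    using hausdorff_outer_delta_less by metis
  then obtain C where C: "\<And>m. A \<subseteq> (\<Union>i. C m i)" "\<And>m i. bounded (C m i)"
      "\<And>m. (\<Sum>i. ennreal (haus_gauge (real DIM('a)) (C m i))) < ennreal (1 / real (Suc m))"
    by metis
  define N where "N = (\<Inter>m. \<Union>i. closure (C m i))"
  have [measurable]: "N \<in> sets borel" unfolding N_def by measurable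
  have le: "emeasure lborel N \<le> ennreal (1 / real (Suc m))" for m
  proof -
    have "emeasure lborel N \<le> emeasure lborel (\<Union>i. closure (C m i))"
      by (rule emeasure_mono) (auto simp: N_def)
    also have "\<dots> \<le> (\<Sum>i. ennreal (haus_gauge (real DIM('a)) (C m i)))"
      by (rule emeasure_lborel_cover_le[OF C(2)])
    finally show ?thesis using C(3)[of m] by simp
  qed
  have "emeasure lborel N \<le> 0"
  proof (rule ennreal_le_epsilon)
    fix e :: real assume "0 < e"
    then obtain m where "1 / real (Suc m) < e"
      using reals_Archimedean[of e] by (auto simp: inverse_eq_divide)
    then have "ennreal (1 / real (Suc m)) \<le> ennreal e" by (intro ennreal_leI) simp
    then show "emeasure lborel N \<le> 0 + ennreal e" using le[of m] by simp
  qed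
  moreover have "A \<subseteq> N"
    unfolding N_def
  proof (rule INT_greatest)
    fix m
    have "(\<Union>i. C m i) \<subseteq> (\<Union>i. closure (C m i))" by (rule UN_mono) (auto intro: closure_subset[THEN subsetD])
    with C(1)[of m] show "A \<subseteq> (\<Union>i. closure (C m i))" by (rule order_trans)
  qed
  ultimately show ?thesis by (intro that[of N]) auto
qed

section \<open>Upper bounds from Vitali coverings\<close>

lemma hausdorff_outer_delta_countable:
  fixes C :: "'i \<Rightarrow> 'a::metric_space set"
  assumes I: "countable I" and A: "A \<subseteq> (\<Union>i\<in>I. C i)" and \<delta>: "0 \<le> \<delta>"
    and C: "\<And>i. i \<in> I \<Longrightarrow> bounded (C i)" "\<And>i. i \<in> I \<Longrightarrow> diameter (C i) \<le> \<delta>"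
  shows "hausdorff_outer_delta s \<delta> A \<le> (\<integral>\<^sup>+i. ennreal (haus_gauge s (C i)) \<partial>count_space I)"
proof -
  let ?J = "to_nat_on I ` I"
  \<comment> \<open>The countable family is enumerated by its codes, and codes that are not taken
    are filled with {}, whose gauge is 0.\<close>
  define D where "D k = (if k \<in> ?J then C (from_nat_into I k) else {})" for k
  have D: "i \<in> I \<Longrightarrow> D (to_nat_on I i) = C i" for i using I by (simp add: D_def)
  have "hausdorff_outer_delta s \<delta> A \<le> (\<Sum>k. ennreal (haus_gauge s (D k)))"
  proof (rule hausdorff_outer_delta_le)
    show "A \<subseteq> (\<Union>k. D k)"
      using A D by blast
    show "bounded (D k)" "diameter (D k) \<le> \<delta>" for k
      using I C \<delta> by (auto simp: D_def)
  qed
  also have "\<dots> = (\<integral>\<^sup>+k. ennreal (haus_gauge s (D k)) \<partial>count_space UNIV)"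
    by (simp add: nn_integral_count_space_nat)
  also have "\<dots> = (\<integral>\<^sup>+k. ennreal (haus_gauge s (D k)) * indicator ?J k \<partial>count_space UNIV)"
    by (intro nn_integral_cong) (auto simp: D_def indicator_def)
  also have "\<dots> = (\<integral>\<^sup>+k. ennreal (haus_gauge s (D k)) \<partial>count_space ?J)"
    by (rule nn_integral_count_space_indicator[symmetric]) simp
  also have "\<dots> = (\<integral>\<^sup>+i. ennreal (haus_gauge s (D (to_nat_on I i))) \<partial>count_space I)"
    by (rule nn_integral_bij_count_space[symmetric]) (use I in \<open>auto intro: inj_on_imp_bij_betw\<close>)
  also have "\<dots> = (\<integral>\<^sup>+i. ennreal (haus_gauge s (C i)) \<partial>count_space I)"
    by (intro nn_integral_cong) (simp add: D)
  finally show ?thesis .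
qed

lemma haus_gauge_cball:
  fixes y :: "'a::euclidean_space"
  assumes "r \<ge> 0"
  shows "ennreal (haus_gauge (real DIM('a)) (cball y r)) = emeasure lborel (cball y r)"
  using assms by (simp add: haus_gauge_DIM diameter_cball emeasure_cball)

lemma emeasure_disjoint_cballs:
  fixes C :: "('a::euclidean_space \<times> real) set"
  assumes "countable C" "pairwise (\<lambda>i j. disjnt (cball (fst i) (snd i)) (cball (fst j) (snd j))) C"
  shows "(\<integral>\<^sup>+i. emeasure lborel (cball (fst i) (snd i)) \<partial>count_space C)
    = emeasure lborel (\<Union>i\<in>C. cball (fst i) (snd i))"
  by (rule emeasure_UN_countable[symmetric])
     (use assms in \<open>auto simp: disjoint_family_on_def pairwise_def disjnt_def\<close>)

text \<open>N sits in an open set U of small measure. Disjoint balls inside U can be chosen such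
  that their fivefold enlargements cover N, and enlargement multiplies the total volume by 5 to the
  dimension.\<close>

lemma hausdorff_outer_null:
  fixes N :: "'a::euclidean_space set"
  assumes N: "N \<in> null_sets lborel"
  shows "hausdorff_outer (real DIM('a)) N = 0"
proof -
  let ?n = "real DIM('a)"
  have "hausdorff_outer_delta ?n \<delta> N \<le> ennreal e" if \<delta>: "\<delta> > 0" and e: "e > 0" for \<delta> e
  proof -
    \<comment> \<open>The factor 5 ^ DIM lost by the enlargement is paid in advance.\<close>
    define c where "c = e / 5 ^ DIM('a)"
    have c: "c > 0" using e by (simp add: c_def)
    have "N \<in> sets borel" using null_setsD2[OF N] by simp
    then obtain U where U: "open U" "N \<subseteq> U" "emeasure lborel (U - N) < ennreal c"
      using outer_regular_lborel c by blast
    have "emeasure lborel U = emeasure lborel (N \<union> (U - N))" using U(2) by (simp add: Un_absorb1)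
    also have "\<dots> \<le> emeasure lborel N + emeasure lborel (U - N)"
      using N U(1) by (intro emeasure_subadditive) auto
    also have "\<dots> \<le> ennreal c" using U(3) N by auto
    finally have Uc: "emeasure lborel U \<le> ennreal c" .
    \<comment> \<open>Radius at most \<open>\<delta> / 10\<close> makes the diameter of the fivefold
      ball at most \<open>\<delta>\<close>.\<close>
    define K where "K = {i. fst i \<in> N \<and> 0 < snd i \<and> snd i \<le> \<delta> / 10 \<and> cball (fst i) (snd i) \<subseteq> U}"
    have "N \<subseteq> (\<Union>i\<in>K. cball (fst i) (snd i))"
    proof
      fix y assume y: "y \<in> N"
      then obtain r where r: "r > 0" "cball y r \<subseteq> U" using U open_contains_cball by blast
      have "cball y (min r (\<delta> / 10)) \<subseteq> U" using r(2) by auto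
      then have "(y, min r (\<delta> / 10)) \<in> K" using y r(1) \<delta> by (simp add: K_def)
      moreover have "y \<in> cball (fst (y, min r (\<delta> / 10))) (snd (y, min r (\<delta> / 10)))"
        using r(1) \<delta> by simp
      ultimately show "y \<in> (\<Union>i\<in>K. cball (fst i) (snd i))" by blast
    qed
    then obtain C where C: "countable C" "C \<subseteq> K"
        "pairwise (\<lambda>i j. disjnt (cball (fst i) (snd i)) (cball (fst j) (snd j))) C"
        "N \<subseteq> (\<Union>i\<in>C. cball (fst i) (5 * snd i))"
      by (rule Vitali_covering_lemma_cballs[where B="\<delta> / 10"]) (auto simp: K_def)
    have pos: "0 < snd i" "snd i \<le> \<delta> / 10" "cball (fst i) (snd i) \<subseteq> U" if "i \<in> C" for i
      using C(2) that by (auto simp: K_def)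
    have "hausdorff_outer_delta ?n \<delta> N \<le> (\<integral>\<^sup>+i. ennreal (haus_gauge ?n (cball (fst i) (5 * snd i))) \<partial>count_space C)"
    proof (rule hausdorff_outer_delta_countable[OF C(1,4)])
      show "diameter (cball (fst i) (5 * snd i)) \<le> \<delta>" if "i \<in> C" for i
        using pos[OF that] \<delta> by (simp add: diameter_cball)
    qed (use \<delta> in auto)
    also have "\<dots> = (\<integral>\<^sup>+i. ennreal (5 ^ DIM('a)) * emeasure lborel (cball (fst i) (snd i)) \<partial>count_space C)"
    proof (rule nn_integral_cong)
      fix i assume "i \<in> space (count_space C)"
      then have "0 < snd i" using pos by simp
      then show "ennreal (haus_gauge ?n (cball (fst i) (5 * snd i)))
          = ennreal (5 ^ DIM('a)) * emeasure lborel (cball (fst i) (snd i))"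
        by (simp add: haus_gauge_cball emeasure_cball power_mult_distrib ac_simps flip: ennreal_mult)
    qed
    also have "\<dots> = ennreal (5 ^ DIM('a)) * emeasure lborel (\<Union>i\<in>C. cball (fst i) (snd i))"
      by (simp add: nn_integral_cmult emeasure_disjoint_cballs[OF C(1,3)])
    also have "\<dots> \<le> ennreal (5 ^ DIM('a)) * ennreal c"
    proof (intro mult_left_mono)
      have "emeasure lborel (\<Union>i\<in>C. cball (fst i) (snd i)) \<le> emeasure lborel U"
      proof (rule emeasure_mono)
        show "(\<Union>i\<in>C. cball (fst i) (snd i)) \<subseteq> U" using pos(3) by blast
      qed (use U in simp)
      then show "emeasure lborel (\<Union>i\<in>C. cball (fst i) (snd i)) \<le> ennreal c" using Uc by simp
    qed simp
    also have "\<dots> = ennreal (5 ^ DIM('a) * c)" by (rule ennreal_mult[symmetric]) (use c in auto)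
    also have "5 ^ DIM('a) * c = e" by (simp add: c_def)
    finally show ?thesis .
  qed
  then have "hausdorff_outer_delta ?n \<delta> N = 0" if "\<delta> > 0" for \<delta>
    using that by (metis add_0 ennreal_le_epsilon le_zero_eq)
  then show ?thesis unfolding hausdorff_outer_def by simp
qed

text \<open>Small disjoint balls fill U up to a null set, which has Hausdorff measure 0 by the
  previous lemma, and for a ball the gauge is exactly its volume. No enlargement occurs, hence no
  constant is lost.\<close>

lemma hausdorff_outer_open_le:
  fixes U :: "'a::euclidean_space set"
  assumes U: "open U"
  shows "hausdorff_outer (real DIM('a)) U \<le> emeasure lborel U"
  unfolding hausdorff_outer_def
proof (rule SUP_least)
  let ?n = "real DIM('a)"
  fix \<delta> :: real assume "\<delta> \<in> {0<..}"
  then have \<delta>: "\<delta> > 0" by simp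
  define K where "K = {i. 0 < snd i \<and> snd i \<le> \<delta> / 2 \<and> cball (fst i) (snd i) \<subseteq> U}"
  have K: "\<exists>i. i \<in> K \<and> y \<in> cball (fst i) (snd i) \<and> snd i < d" if y: "y \<in> U" and d: "0 < d" for y d
  proof -
    obtain r where r: "r > 0" "cball y r \<subseteq> U" using U y open_contains_cball by blast
    define t where "t = min r (min (\<delta> / 2) (d / 2))"
    have "0 < t" "t \<le> r" "t \<le> \<delta> / 2" "t < d" using r \<delta> d by (auto simp: t_def)
    moreover from this have "cball y t \<subseteq> U" using r(2) by auto
    ultimately show ?thesis by (intro exI[of _ "(y, t)"]) (simp add: K_def)
  qed
  obtain C where C: "countable C" "C \<subseteq> K"
      "pairwise (\<lambda>i j. disjnt (cball (fst i) (snd i)) (cball (fst j) (snd j))) C"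
      "negligible (U - (\<Union>i\<in>C. cball (fst i) (snd i)))"
    by (rule Vitali_covering_theorem_cballs[of K snd U fst]) (use K in \<open>auto simp: K_def\<close>)
  let ?V = "\<Union>i\<in>C. cball (fst i) (snd i)"
  have pos: "0 < snd i" "snd i \<le> \<delta> / 2" "cball (fst i) (snd i) \<subseteq> U" if "i \<in> C" for i
    using C(2) that by (auto simp: K_def)
  have V: "?V \<in> sets borel" using C(1) by (intro sets.countable_UN'') auto
  then have null: "U - ?V \<in> null_sets lborel"
    using C(4) U by (simp add: negligible_iff_null_sets null_sets_completion_iff)
  have "hausdorff_outer_delta ?n \<delta> ((U - ?V) \<union> ?V) \<le> hausdorff_outer_delta ?n \<delta> (U - ?V) + hausdorff_outer_delta ?n \<delta> ?V"
    by (rule hausdorff_outer_delta_Un[OF \<delta>])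
  also have "hausdorff_outer_delta ?n \<delta> (U - ?V) = 0"
    using hausdorff_outer_null[OF null] hausdorff_outer_delta_le_outer[OF \<delta>, of ?n "U - ?V"] by simp
  also have "hausdorff_outer_delta ?n \<delta> ?V \<le> (\<integral>\<^sup>+i. ennreal (haus_gauge ?n (cball (fst i) (snd i))) \<partial>count_space C)"
  proof (rule hausdorff_outer_delta_countable[OF C(1) order_refl])
    show "diameter (cball (fst i) (snd i)) \<le> \<delta>" if "i \<in> C" for i
      using pos[OF that] \<delta> by (simp add: diameter_cball)
  qed (use \<delta> in auto)
  also have "\<dots> = (\<integral>\<^sup>+i. emeasure lborel (cball (fst i) (snd i)) \<partial>count_space C)"
    by (rule nn_integral_cong) (use pos in \<open>auto intro: haus_gauge_cball less_imp_le\<close>)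
  also have "\<dots> = emeasure lborel ?V" by (rule emeasure_disjoint_cballs[OF C(1,3)])
  also have "\<dots> \<le> emeasure lborel U"
  proof (rule emeasure_mono)
    show "?V \<subseteq> U" using pos(3) by blast
  qed (use U in simp)
  finally have "hausdorff_outer_delta ?n \<delta> ((U - ?V) \<union> ?V) \<le> emeasure lborel U" by simp
  then show "hausdorff_outer_delta ?n \<delta> U \<le> emeasure lborel U"
    by (rule order_trans[OF hausdorff_outer_delta_mono, rotated]) auto
qed

text \<open>The upper bound passes from open sets to Borel sets by outer regularity.\<close>

theorem hausdorff_outer_eq_lborel:
  fixes A :: "'a::euclidean_space set"
  assumes A: "A \<in> sets borel"
  shows "hausdorff_outer (real DIM('a)) A = emeasure lborel A"
proof (rule antisym)
  show "hausdorff_outer (real DIM('a)) A \<le> emeasure lborel A"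
  proof (rule ennreal_le_epsilon)
    fix e :: real assume "0 < e"
    then obtain U where U: "open U" "A \<subseteq> U" "emeasure lborel (U - A) < ennreal e"
      using outer_regular_lborel[OF A, of e] by auto
    have "hausdorff_outer (real DIM('a)) A \<le> emeasure lborel U"
      using hausdorff_outer_mono[OF U(2)] hausdorff_outer_open_le[OF U(1)] by (rule order_trans)
    also have "emeasure lborel U = emeasure lborel (A \<union> (U - A))" using U(2) by (simp add: Un_absorb1)
    also have "\<dots> \<le> emeasure lborel A + emeasure lborel (U - A)"
      using A U(1) by (intro emeasure_subadditive) auto
    also have "\<dots> \<le> emeasure lborel A + ennreal e" using U(3) by (intro add_left_mono) simp
    finally show "hausdorff_outer (real DIM('a)) A \<le> emeasure lborel A + ennreal e" .
  qed
qed (rule emeasure_lborel_le_hausdorff_outer[OF A])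

section \<open>Isometries and dimension\<close>

lemma haus_gauge_mono:
  assumes "s \<ge> 0" "bounded C" "bounded D" "C \<noteq> {} \<Longrightarrow> D \<noteq> {}" "diameter C \<le> diameter D"
  shows "haus_gauge s C \<le> haus_gauge s D"
  using assms diameter_ge_0[of C] diameter_ge_0[of D]
  by (auto simp: haus_gauge_def intro!: mult_left_mono powr_mono2 mult_nonneg_nonneg)

text \<open>f is controlled on A only, so the cover is cut down to A before images are taken. This
  form also applies to \<open>inv f\<close> on the range of an isometry f.\<close>

lemma hausdorff_outer_delta_nonexpansive:
  fixes f :: "'a::metric_space \<Rightarrow> 'b::metric_space"
  assumes s: "s \<ge> 0" and \<delta>: "\<delta> \<ge> 0"
    and f: "\<And>x y. x \<in> A \<Longrightarrow> y \<in> A \<Longrightarrow> dist (f x) (f y) \<le> dist x y"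
  shows "hausdorff_outer_delta s \<delta> (f ` A) \<le> hausdorff_outer_delta s \<delta> A"
  unfolding hausdorff_outer_delta_def[of s \<delta> A]
proof (rule INF_greatest, clarsimp)
  fix C :: "nat \<Rightarrow> 'a set"
  assume A: "A \<subseteq> (\<Union>i. C i)" and C: "\<forall>i. bounded (C i) \<and> diameter (C i) \<le> \<delta>"
  have d: "dist p q \<le> diameter (C i)" if "p \<in> f ` (A \<inter> C i)" "q \<in> f ` (A \<inter> C i)" for p q i
  proof -
    obtain x y where xy: "x \<in> A \<inter> C i" "y \<in> A \<inter> C i" "p = f x" "q = f y" using \<open>p \<in> _\<close> \<open>q \<in> _\<close> by blast
    have "dist (f x) (f y) \<le> dist x y" using xy by (intro f) auto
    also have "\<dots> \<le> diameter (C i)" using xy C by (intro diameter_bounded_bound) auto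
    finally show ?thesis using xy by simp
  qed
  have bd: "bounded (f ` (A \<inter> C i))" for i
    using d[of _ i] unfolding bounded_two_points by blast
  have diam: "diameter (f ` (A \<inter> C i)) \<le> diameter (C i)" for i
  proof (cases "f ` (A \<inter> C i) = {}")
    case False
    have "(SUP (x, y)\<in>f ` (A \<inter> C i) \<times> f ` (A \<inter> C i). dist x y) \<le> diameter (C i)"
      using False d[of _ i] by (intro cSUP_least) auto
    then show ?thesis using False by (simp add: diameter_def)
  qed (use C diameter_ge_0 in auto)
  have "hausdorff_outer_delta s \<delta> (f ` A) \<le> (\<Sum>i. ennreal (haus_gauge s (f ` (A \<inter> C i))))"
  proof (rule hausdorff_outer_delta_le)
    show "f ` A \<subseteq> (\<Union>i. f ` (A \<inter> C i))" using A by blast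
    show "diameter (f ` (A \<inter> C i)) \<le> \<delta>" for i
      using diam[of i] C by (meson order_trans)
  qed (rule bd)
  also have "\<dots> \<le> (\<Sum>i. ennreal (haus_gauge s (C i)))"
    using s C bd diam by (intro suminf_le ennreal_leI haus_gauge_mono) auto
  finally show "hausdorff_outer_delta s \<delta> (f ` A) \<le> (\<Sum>i. ennreal (haus_gauge s (C i)))" .
qed

lemma hausdorff_outer_nonexpansive:
  fixes f :: "'a::metric_space \<Rightarrow> 'b::metric_space"
  assumes "s \<ge> 0" "\<And>x y. x \<in> A \<Longrightarrow> y \<in> A \<Longrightarrow> dist (f x) (f y) \<le> dist x y"
  shows "hausdorff_outer s (f ` A) \<le> hausdorff_outer s A"
  unfolding hausdorff_outer_def
  by (rule SUP_mono) (use assms in \<open>auto intro!: hausdorff_outer_delta_nonexpansive bexI\<close>)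

lemma hausdorff_outer_isometry:
  fixes f :: "'a::metric_space \<Rightarrow> 'b::metric_space"
  assumes s: "s \<ge> 0" and f: "\<And>x y. dist (f x) (f y) = dist x y"
  shows "hausdorff_outer s (f ` A) = hausdorff_outer s A"
proof (rule antisym)
  show "hausdorff_outer s (f ` A) \<le> hausdorff_outer s A"
    by (rule hausdorff_outer_nonexpansive) (use s f in auto)
  have "inj f" using f by (metis dist_eq_0_iff injI)
  then have "hausdorff_outer s (inv f ` f ` A) \<le> hausdorff_outer s (f ` A)"
    using s f by (intro hausdorff_outer_nonexpansive) auto
  then show "hausdorff_outer s A \<le> hausdorff_outer s (f ` A)" using \<open>inj f\<close> by (simp add: image_inv_f_f)
qed

lemma borel_measurable_isometry:
  fixes f :: "'a::metric_space \<Rightarrow> 'b::metric_space"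
  assumes f: "\<And>x y. dist (f x) (f y) = dist x y"
  shows "f \<in> borel_measurable borel"
  by (intro borel_measurable_continuous_onI) (auto simp: continuous_on_iff f)

lemma distr_lborel_isometry:
  fixes f :: "'a::euclidean_space \<Rightarrow> 'b::euclidean_space"
  assumes f: "\<And>x y. dist (f x) (f y) = dist x y" and "surj f" and dim: "DIM('a) = DIM('b)"
  shows "distr lborel borel f = lborel"
proof (rule measure_eqI)
  fix A assume "A \<in> sets (distr lborel borel f)"
  then have A: "A \<in> sets borel" by simp
  have [measurable]: "f \<in> borel_measurable borel" by (rule borel_measurable_isometry[OF f])
  have "f -` A \<in> sets borel" using A measurable_sets[of f borel borel A] by simp
  then have "emeasure lborel (f -` A) = hausdorff_outer (real DIM('a)) (f ` (f -` A))"
    by (simp add: hausdorff_outer_eq_lborel hausdorff_outer_isometry[OF _ f] del: image_vimage_eq)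
  also have "f ` (f -` A) = A" using \<open>surj f\<close> by (simp add: surj_image_vimage_eq)
  finally show "emeasure (distr lborel borel f) A = emeasure lborel A"
    using A by (simp add: emeasure_distr dim hausdorff_outer_eq_lborel)
qed simp

text \<open>Hausdorff measure of dimension below that of the ambient space is not sigma-finite
  there; cut down to the range of the chart it becomes an image of Lebesgue measure, where the usual
  integration theorems apply.\<close>

lemma density_hausdorff_measure_isometry:
  fixes f :: "'a::euclidean_space \<Rightarrow> 'b::euclidean_space"
  assumes f: "\<And>x y. dist (f x) (f y) = dist x y" and rng: "range f \<in> sets borel"
  shows "density (hausdorff_measure (real DIM('a))) (indicator (range f)) = distr lborel borel f"
proof (rule measure_eqI)
  fix A assume "A \<in> sets (density (hausdorff_measure (real DIM('a))) (indicator (range f)))"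
  then have A: "A \<in> sets borel" by simp
  have [measurable]: "f \<in> borel_measurable borel" by (rule borel_measurable_isometry[OF f])
  have vA: "f -` A \<in> sets borel" using A measurable_sets[of f borel borel A] by simp
  have "emeasure (density (hausdorff_measure (real DIM('a))) (indicator (range f))) A
      = (\<integral>\<^sup>+y. indicator (A \<inter> range f) y \<partial>hausdorff_measure (real DIM('a)))"
    unfolding Int_commute[of A] indicator_inter_arith
    by (rule emeasure_density) (use A rng in auto)
  also have "\<dots> = hausdorff_outer (real DIM('a)) (A \<inter> range f)"
    using A rng by (simp add: emeasure_hausdorff_measure)
  also have "A \<inter> range f = f ` (f -` A)" by auto
  also have "hausdorff_outer (real DIM('a)) (f ` (f -` A)) = emeasure lborel (f -` A)"
    using vA by (simp add: hausdorff_outer_eq_lborel hausdorff_outer_isometry[OF _ f] del: image_vimage_eq)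
  finally show "emeasure (density (hausdorff_measure (real DIM('a))) (indicator (range f))) A
      = emeasure (distr lborel borel f) A"
    using A by (simp add: emeasure_distr)
qed simp

lemma integral_hausdorff_measure_isometry:
  fixes f :: "'a::euclidean_space \<Rightarrow> 'b::euclidean_space" and g :: "'b \<Rightarrow> real"
  assumes f: "\<And>x y. dist (f x) (f y) = dist x y" and rng: "range f \<in> sets borel"
    and g: "g \<in> borel_measurable borel" and g0: "\<And>y. y \<notin> range f \<Longrightarrow> g y = 0"
  shows "(\<integral>y. g y \<partial>hausdorff_measure (real DIM('a))) = (\<integral>w. g (f w) \<partial>lborel)"
proof -
  have "(\<integral>y. g y \<partial>hausdorff_measure (real DIM('a)))
      = (\<integral>y. indicator (range f) y *\<^sub>R g y \<partial>hausdorff_measure (real DIM('a)))"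
    by (intro Bochner_Integration.integral_cong) (auto simp: indicator_def g0)
  also have "\<dots> = (\<integral>y. g y \<partial>density (hausdorff_measure (real DIM('a))) (\<lambda>y. ennreal (indicator (range f) y)))"
    using rng g by (intro integral_density[symmetric]) auto
  also have "\<dots> = (\<integral>y. g y \<partial>distr lborel borel f)"
    by (simp add: density_hausdorff_measure_isometry[OF f rng] ennreal_indicator)
  also have "\<dots> = (\<integral>w. g (f w) \<partial>lborel)"
    using borel_measurable_isometry[OF f] g by (intro integral_distr) auto
  finally show ?thesis .
qed

section \<open>Gauges of different dimensions and the Hausdorff dimension\<close>

lemma haus_gauge_le_lower_dim:
  assumes st: "0 \<le> s" "s < t" and C: "bounded C" "diameter C \<le> \<delta>"
  shows "haus_gauge t C \<le> unit_ball_vol t / unit_ball_vol s * (\<delta> / 2) powr (t - s) * haus_gauge s C"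
proof (cases "C = {}")
  case False
  let ?r = "diameter C / 2"
  have r: "0 \<le> ?r" "?r \<le> \<delta> / 2" using diameter_ge_0[OF C(1)] C(2) by auto
  have pos: "unit_ball_vol s > 0" "unit_ball_vol t > 0" using st by auto
  have "?r powr (t - s) \<le> (\<delta> / 2) powr (t - s)" using r st by (intro powr_mono2) auto
  moreover have "haus_gauge t C \<le> unit_ball_vol t / unit_ball_vol s * ?r powr (t - s) * haus_gauge s C"
  proof (cases "s = 0")
    case True
    then show ?thesis using False st by (simp add: haus_gauge_def)
  next
    case s: False
    have "?r powr t = ?r powr (t - s) * ?r powr s" by (simp flip: powr_add)
    moreover have "unit_ball_vol s \<noteq> 0" using pos by simp
    ultimately show ?thesis using False s st by (simp add: haus_gauge_def)
  qed
  moreover have "0 \<le> haus_gauge s C" using pos by (simp add: haus_gauge_def)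
  ultimately show ?thesis using pos
    by (meson divide_nonneg_pos less_imp_le mult_left_mono mult_right_mono order_trans)
qed simp

lemma hausdorff_outer_delta_le_lower_dim:
  assumes st: "0 \<le> s" "s < t" and \<delta>: "\<delta> > 0"
  shows "hausdorff_outer_delta t \<delta> A
    \<le> ennreal (unit_ball_vol t / unit_ball_vol s * (\<delta> / 2) powr (t - s)) * hausdorff_outer_delta s \<delta> A"
proof -
  define K where "K = unit_ball_vol t / unit_ball_vol s * (\<delta> / 2) powr (t - s)"
  have K: "K > 0" using st \<delta> by (auto simp: K_def intro!: mult_pos_pos divide_pos_pos)
  \<comment> \<open>Division moves the constant to the side without the infimum, so that each cover
    can be estimated separately.\<close>
  have "hausdorff_outer_delta t \<delta> A / ennreal K \<le> hausdorff_outer_delta s \<delta> A"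
    unfolding hausdorff_outer_delta_def[of s]
  proof (rule INF_greatest, clarsimp)
    fix C :: "nat \<Rightarrow> 'a set"
    assume C: "A \<subseteq> (\<Union>i. C i)" "\<forall>i. bounded (C i) \<and> diameter (C i) \<le> \<delta>"
    have "hausdorff_outer_delta t \<delta> A \<le> (\<Sum>i. ennreal (haus_gauge t (C i)))"
      by (rule hausdorff_outer_delta_le) (use C in auto)
    also have "\<dots> \<le> (\<Sum>i. ennreal K * ennreal (haus_gauge s (C i)))"
    proof (intro suminf_le)
      fix i
      have "haus_gauge t (C i) \<le> K * haus_gauge s (C i)"
        unfolding K_def by (rule haus_gauge_le_lower_dim) (use st C in auto)
      then show "ennreal (haus_gauge t (C i)) \<le> ennreal K * ennreal (haus_gauge s (C i))"
        using K by (simp add: ennreal_leI flip: ennreal_mult')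
    qed auto
    also have "\<dots> = ennreal K * (\<Sum>i. ennreal (haus_gauge s (C i)))" by simp
    finally show "hausdorff_outer_delta t \<delta> A / ennreal K \<le> (\<Sum>i. ennreal (haus_gauge s (C i)))"
      using K by (intro divide_le_posI_ennreal) auto
  qed
  then have "ennreal K * (hausdorff_outer_delta t \<delta> A / ennreal K) \<le> ennreal K * hausdorff_outer_delta s \<delta> A"
    by (intro mult_left_mono) auto
  also have "ennreal K * (hausdorff_outer_delta t \<delta> A / ennreal K) = hausdorff_outer_delta t \<delta> A"
    using K by (simp add: ennreal_times_divide mult_divide_eq_ennreal mult.commute[of "ennreal K"])
  finally show ?thesis unfolding K_def .
qed

lemma hausdorff_outer_zero_mono:
  assumes st: "0 \<le> s" "s \<le> t" and 0: "hausdorff_outer s A = 0"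
  shows "hausdorff_outer t A = 0"
proof (cases "s = t")
  case False
  have "hausdorff_outer_delta t \<delta> A = 0" if "\<delta> > 0" for \<delta>
    using hausdorff_outer_delta_le_lower_dim[of s t \<delta> A] that st False 0
      hausdorff_outer_delta_le_outer[OF that, of s A] by simp
  then show ?thesis by (simp add: hausdorff_outer_def)
qed (use 0 in simp)

text \<open>This makes the set under the infimum in \<open>hausdorff_dimension\<close> nonempty, so
  the infimum is meaningful. On a ball the value at scale \<open>\<delta>\<close> is at most a
  constant times \<open>\<delta>\<close>, one power of the diameter being left over.\<close>

lemma hausdorff_outer_Suc_DIM:
  "hausdorff_outer (real DIM('a) + 1) (UNIV :: 'a::euclidean_space set) = 0"
proof -
  let ?n = "real DIM('a)"
  have ball0: "hausdorff_outer (?n + 1) (ball (0::'a) (real m)) = 0" for m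
  proof -
    define K where "K = unit_ball_vol (?n + 1) / unit_ball_vol ?n * measure lborel (ball (0::'a) (real m))"
    have K: "K \<ge> 0" by (simp add: K_def)
    have le: "hausdorff_outer_delta (?n + 1) \<delta> (ball (0::'a) (real m)) \<le> ennreal (K * \<delta>)" if \<delta>: "\<delta> > 0" for \<delta>
    proof -
      have "hausdorff_outer_delta ?n \<delta> (ball (0::'a) (real m)) \<le> emeasure lborel (ball (0::'a) (real m))"
        using hausdorff_outer_delta_le_outer[OF \<delta>, of ?n "ball (0::'a) (real m)"]
        by (simp add: hausdorff_outer_eq_lborel)
      also have "\<dots> = ennreal (measure lborel (ball (0::'a) (real m)))"
        using emeasure_bounded_finite[of "ball (0::'a) (real m)"]
        by (intro emeasure_eq_ennreal_measure) auto
      finally have "hausdorff_outer_delta (?n + 1) \<delta> (ball (0::'a) (real m))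
         \<le> ennreal (unit_ball_vol (?n + 1) / unit_ball_vol ?n * (\<delta> / 2) powr 1) * ennreal (measure lborel (ball (0::'a) (real m)))"
        using hausdorff_outer_delta_le_lower_dim[of ?n "?n + 1" \<delta> "ball (0::'a) (real m)"] \<delta>
        by (simp add: mult_left_mono order_trans)
      also have "\<dots> = ennreal (K * \<delta> / 2)"
        using \<delta> by (simp add: K_def field_simps flip: ennreal_mult)
      also have "\<dots> \<le> ennreal (K * \<delta>)" using K \<delta> by (intro ennreal_leI) simp
      finally show ?thesis .
    qed
    have "hausdorff_outer_delta (?n + 1) \<delta> (ball (0::'a) (real m)) \<le> 0" if \<delta>: "\<delta> > 0" for \<delta>
    proof (rule ennreal_le_epsilon)
      fix e :: real assume e: "0 < e"
      \<comment> \<open>Refining the scale only increases the value, so the estimate at the smaller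
        d bounds it. K + 1 avoids division by 0.\<close>
      define d where "d = min \<delta> (e / (K + 1))"
      have d: "d > 0" "d \<le> \<delta>" "d \<le> e / (K + 1)" using \<delta> e K by (auto simp: d_def)
      have "K * d \<le> (K + 1) * d" using d by (intro mult_right_mono) auto
      also have "\<dots> \<le> e" using d(3) K by (simp add: field_simps)
      finally have "K * d \<le> e" .
      have "hausdorff_outer_delta (?n + 1) \<delta> (ball (0::'a) (real m))
          \<le> hausdorff_outer_delta (?n + 1) d (ball (0::'a) (real m))"
        by (rule hausdorff_outer_delta_antimono[OF d(2)])
      also have "\<dots> \<le> ennreal (K * d)" by (rule le[OF d(1)])
      also have "\<dots> \<le> 0 + ennreal e" using \<open>K * d \<le> e\<close> by (simp add: ennreal_leI)
      finally show "hausdorff_outer_delta (?n + 1) \<delta> (ball (0::'a) (real m)) \<le> 0 + ennreal e" .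
    qed
    then show ?thesis by (simp add: hausdorff_outer_def)
  qed
  have "(UNIV :: 'a set) = (\<Union>m. ball 0 (real m))"
    using reals_Archimedean2 by auto
  then have "hausdorff_outer (?n + 1) (UNIV :: 'a set) \<le> (\<Sum>m. hausdorff_outer (?n + 1) (ball (0::'a) (real m)))"
    using hausdorff_outer_UN[of "?n + 1" "\<lambda>m. ball (0::'a) (real m)"] by simp
  then show ?thesis by (simp add: ball0)
qed

text \<open>With t = DIM - 1, the first part shows that A3 forces dimension at least two, and the
  second that the discontinuities of \<open>\<phi>\<close> are null for the measure on
  hyperplanes.\<close>

lemma hausdorff_dimension_less:
  fixes A :: "'a::euclidean_space set"
  assumes "hausdorff_dimension A < t"
  shows "0 < t" "hausdorff_outer t A = 0"
proof -
  let ?S = "{s. s \<ge> 0 \<and> hausdorff_outer s A = 0}"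
  have "hausdorff_outer (real DIM('a) + 1) A \<le> 0"
    using hausdorff_outer_mono[of A UNIV "real DIM('a) + 1"] by (simp add: hausdorff_outer_Suc_DIM)
  then have "real DIM('a) + 1 \<in> ?S" by simp
  then have "?S \<noteq> {}" by blast
  then obtain s where s: "s \<ge> 0" "hausdorff_outer s A = 0" "s < t"
    using assms cInf_lessD[of ?S t] unfolding hausdorff_dimension_def by blast
  show "0 < t" using s by simp
  show "hausdorff_outer t A = 0" by (rule hausdorff_outer_zero_mono[of s]) (use s in auto)
qed

text \<open>An index type with one element fewer than the dimension, so that \<open>real ^ 'a coord_idx\<close>
  parametrises the hyperplanes of \<open>'a\<close>.  The \<open>max\<close> only keeps the type inhabited in dimension one.\<close>
typedef (overloaded) ('a::euclidean_space) coord_idx = "{..<max 1 (DIM('a) - 1)}"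
  by (rule exI[of _ 0]) simp

lemma UNIV_coord_idx: "(UNIV :: 'a::euclidean_space coord_idx set) = Abs_coord_idx ` {..<max 1 (DIM('a) - 1)}"
  by (rule type_definition.univ[OF type_definition_coord_idx])

instance coord_idx :: (euclidean_space) finite
  by standard (simp only: UNIV_coord_idx finite_imageI finite_lessThan)

lemma CARD_coord_idx: "2 \<le> DIM('a::euclidean_space) \<Longrightarrow> CARD('a coord_idx) = DIM('a) - 1"
  unfolding UNIV_coord_idx
  by (subst card_image) (auto simp: inj_on_def Abs_coord_idx_inject)

section \<open>Charts adapted to a hyperplane\<close>

lemma AE_lborel_notin_negligible:
  assumes "negligible N"
  shows "AE y in lborel. y \<notin> N"
proof -
  obtain N' where "N' \<in> null_sets lborel" "N \<subseteq> N'"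
    using assms by (auto simp: negligible_iff_null_sets null_sets_completion_iff2)
  then show ?thesis by (auto intro: AE_I')
qed

lemma hyperplane_isometry:
  fixes u :: "'a::euclidean_space"
  assumes "u \<noteq> 0" and dim: "DIM('a) = DIM('b::euclidean_space) + 1"
  obtains L :: "'b::euclidean_space \<Rightarrow> 'a"
    where "linear L" "\<And>w. norm (L w) = norm w" "range L = {y. u \<bullet> y = 0}"
proof -
  have "dim (UNIV :: 'b set) = dim {y. u \<bullet> y = 0}"
    using assms by (simp add: dim_hyperplane)
  then show ?thesis
    using that isometry_subspaces[OF subspace_UNIV subspace_hyperplane] by (metis UNIV_I)
qed

text \<open>L maps isometrically onto the hyperplane through 0 with unit normal u. Then (w, t) |-> L
  w + t u is an isometry of the product onto the whole space, and t is the signed height above the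
  hyperplane.\<close>

locale hyperplane_chart =
  fixes L :: "'b::euclidean_space \<Rightarrow> 'a::euclidean_space" and u :: 'a
  assumes lin: "linear L" and nrm: "\<And>w. norm (L w) = norm w"
    and rng: "range L = {y. u \<bullet> y = 0}" and unit: "norm u = 1"
    and dim: "DIM('a) = DIM('b) + 1"
begin

lemma uu: "u \<bullet> u = 1"
  using unit by (simp add: dot_square_norm)

lemma orth: "u \<bullet> L w = 0"
  using rng by blast

lemma inner_chart: "u \<bullet> (L w + t *\<^sub>R u) = t"
  by (simp add: inner_add_right orth uu)

lemma norm_chart: "norm (L w + t *\<^sub>R u) = norm (w, t)"
proof -
  have "(norm (L w + t *\<^sub>R u))\<^sup>2 = (norm (L w))\<^sup>2 + t\<^sup>2"
    by (subst norm_add_Pythagorean) (auto simp: orthogonal_def inner_commute[of _ u] orth unit power_mult_distrib)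
  then have "(norm (L w + t *\<^sub>R u))\<^sup>2 = (norm (w, t))\<^sup>2"
    by (simp add: norm_Pair nrm)
  then show ?thesis by simp
qed

lemma dist_chart: "dist (L w + t *\<^sub>R u) (L w' + t' *\<^sub>R u) = dist (w, t) (w', t')"
  using norm_chart[of "w - w'" "t - t'"]
  by (simp add: dist_norm linear_diff[OF lin] algebra_simps)

lemma dist_slice: "dist (L w + t *\<^sub>R u) (L w' + t *\<^sub>R u) = dist w w'"
  by (simp only: dist_chart) (simp add: dist_Pair_Pair)

lemma chart_exists: obtains w where "y = L w + (u \<bullet> y) *\<^sub>R u"
proof -
  have "u \<bullet> (y - (u \<bullet> y) *\<^sub>R u) = 0" by (simp add: inner_diff_right uu)
  then obtain w where "y - (u \<bullet> y) *\<^sub>R u = L w" using rng by blast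
  then show ?thesis using that by (metis diff_add_cancel)
qed

lemma range_slice: "range (\<lambda>w. L w + t *\<^sub>R u) = {y. u \<bullet> y = t}"
proof (intro subset_antisym subsetI)
  fix y assume "y \<in> {y. u \<bullet> y = t}"
  then show "y \<in> range (\<lambda>w. L w + t *\<^sub>R u)" using chart_exists[of y] by auto
qed (auto simp: inner_chart)

lemma continuous_chart: "continuous_on A (\<lambda>p. L (f p) + g p *\<^sub>R u)"
  if "continuous_on A f" "continuous_on A g"
  using that bounded_linear.continuous_on[OF lin[unfolded linear_conv_bounded_linear] that(1)] by (intro continuous_intros)

lemma distr_chart: "distr lborel borel (\<lambda>p. L (fst p) + snd p *\<^sub>R u) = lborel"
proof (rule distr_lborel_isometry)
  show "surj (\<lambda>p. L (fst p) + snd p *\<^sub>R u)"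
    unfolding surj_def
  proof
    fix y
    obtain w where "y = L w + (u \<bullet> y) *\<^sub>R u" by (rule chart_exists)
    then show "\<exists>p. y = L (fst p) + snd p *\<^sub>R u" by (intro exI[of _ "(w, u \<bullet> y)"]) simp
  qed
  show "DIM('b \<times> real) = DIM('a)" by (simp add: dim)
qed (auto simp: dist_chart)

text \<open>The adapted coordinates preserve Lebesgue measure, and on each normal line t |-> c - s t
  multiplies lengths by s. The minus sign lets positive t run to the side opposite to u, where the
  exchanged mass will lie.\<close>

lemma lborel_chart_scaled:
  assumes s: "s > 0"
  shows "lborel = density (distr lborel borel (\<lambda>p. L (fst p) + (c - s * snd p) *\<^sub>R u)) (\<lambda>_. ennreal s)"
proof (rule measure_eqI)
  fix A :: "'a set" assume "A \<in> sets lborel"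
  then have A: "A \<in> sets borel" by simp
  let ?T = "\<lambda>p. L (fst p) + snd p *\<^sub>R u"
  let ?G = "\<lambda>p. L (fst p) + (c - s * snd p) *\<^sub>R u"
  have mT: "?T \<in> borel_measurable borel" and mG: "?G \<in> borel_measurable borel"
    by (intro borel_measurable_continuous_onI continuous_chart continuous_intros)+
  have T: "?T -` A \<in> sets (lborel \<Otimes>\<^sub>M lborel)" and G: "?G -` A \<in> sets (lborel \<Otimes>\<^sub>M lborel)"
    using measurable_sets[OF mT A] measurable_sets[OF mG A]
    by (simp_all only: lborel_prod sets_lborel space_borel Int_UNIV_right)
  have slice: "emeasure lborel (Pair w -` (?T -` A)) = ennreal s * emeasure lborel (Pair w -` (?G -` A))" for w
  proof -
    have V: "Pair w -` (?T -` A) \<in> sets borel" using sets_Pair1[OF T, of w] by simp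
    have "emeasure lborel (Pair w -` (?T -` A))
      = emeasure (density (distr lborel borel (\<lambda>x. c + (- s) * x)) (\<lambda>_. ennreal \<bar>- s\<bar>)) (Pair w -` (?T -` A))"
      using s by (subst lborel_real_affine[of "- s" c]) auto
    also have "\<dots> = ennreal s * emeasure (distr lborel borel (\<lambda>x. c + (- s) * x)) (Pair w -` (?T -` A))"
      using s V by (subst emeasure_density_const) auto
    also have "emeasure (distr lborel borel (\<lambda>x. c + (- s) * x)) (Pair w -` (?T -` A)) = emeasure lborel (Pair w -` (?G -` A))"
      using V by (subst emeasure_distr) (auto simp: vimage_def)
    finally show ?thesis .
  qed
  have "emeasure lborel A = emeasure (distr lborel borel ?T) A" by (simp add: distr_chart)
  also have "\<dots> = emeasure (lborel \<Otimes>\<^sub>M lborel) (?T -` A)"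
    using mT A by (simp add: emeasure_distr lborel_prod)
  also have "\<dots> = (\<integral>\<^sup>+w. emeasure lborel (Pair w -` (?T -` A)) \<partial>lborel)"
    by (rule lborel.emeasure_pair_measure_alt[OF T])
  also have "\<dots> = (\<integral>\<^sup>+w. ennreal s * emeasure lborel (Pair w -` (?G -` A)) \<partial>lborel)"
    by (simp only: slice)
  also have "\<dots> = ennreal s * (\<integral>\<^sup>+w. emeasure lborel (Pair w -` (?G -` A)) \<partial>lborel)"
    using lborel.measurable_emeasure_Pair[OF G] by (intro nn_integral_cmult) simp
  also have "\<dots> = ennreal s * emeasure (lborel \<Otimes>\<^sub>M lborel) (?G -` A)"
    by (simp only: lborel.emeasure_pair_measure_alt[OF G])
  also have "\<dots> = ennreal s * emeasure (distr lborel borel ?G) A"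
    using mG A by (simp add: emeasure_distr lborel_prod)
  also have "\<dots> = emeasure (density (distr lborel borel ?G) (\<lambda>_. ennreal s)) A"
    using A by (subst emeasure_density_const) auto
  finally show "emeasure lborel A = emeasure (density (distr lborel borel ?G) (\<lambda>_. ennreal s)) A" .
qed simp

lemma integral_chart_scaled:
  fixes F :: "'a \<Rightarrow> real"
  assumes s: "s > 0" and F: "F \<in> borel_measurable borel"
  shows "(\<integral>y. F y \<partial>lborel) = s * (\<integral>p. F (L (fst p) + (c - s * snd p) *\<^sub>R u) \<partial>lborel)"
proof -
  let ?G = "\<lambda>p. L (fst p) + (c - s * snd p) *\<^sub>R u"
  have mG: "?G \<in> borel_measurable borel"
    by (intro borel_measurable_continuous_onI continuous_chart continuous_intros)
  have "(\<integral>y. F y \<partial>lborel) = (\<integral>y. F y \<partial>density (distr lborel borel ?G) (\<lambda>_. ennreal s))"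
    using lborel_chart_scaled[OF s, of c] by simp
  also have "\<dots> = (\<integral>y. s *\<^sub>R F y \<partial>distr lborel borel ?G)"
    using s F by (intro integral_density) auto
  also have "\<dots> = s * (\<integral>p. F (?G p) \<partial>lborel)"
    using mG F by (subst integral_distr) auto
  finally show ?thesis .
qed

text \<open>The slice of Y is convex, so its own frontier is negligible. It contains every slice
  point on the frontier of Y: a point interior to the slice lies strictly between the interior point
  q and some point of Y, hence is interior to Y.\<close>

lemma AE_slice_notin_frontier:
  assumes Y: "closed Y" "convex Y" and q: "q \<in> interior Y" "u \<bullet> q = c"
  shows "AE w in lborel. L w + c *\<^sub>R u \<notin> frontier Y"
proof -
  let ?f = "\<lambda>w. L w + c *\<^sub>R u"
  let ?K = "?f -` Y"
  obtain v where v: "q = ?f v" using chart_exists[of q] q(2) by metis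
  have aff: "?f ((1 - a) *\<^sub>R w + a *\<^sub>R w') = (1 - a) *\<^sub>R ?f w + a *\<^sub>R ?f w'" for a w w'
    by (simp add: linear_add[OF lin] linear_scale[OF lin] linear_diff[OF lin] algebra_simps)
  have K: "convex ?K"
    unfolding convex_alt vimage_eq aff using Y(2) by (auto simp: convex_alt)
  have "w \<in> frontier ?K" if w: "?f w \<in> frontier Y" for w
  proof -
    have wY: "?f w \<in> Y" using w Y(1) by (simp add: frontier_closed subset_iff closure_closed frontier_def)
    have "w \<notin> interior ?K"
    proof
      assume "w \<in> interior ?K"
      then obtain r where r: "r > 0" "cball w r \<subseteq> ?K" unfolding mem_interior_cball by blast
      \<comment> \<open>Chosen so that prolonging the segment from v to w by e (w - v) stays within
        distance r of w; the + 1 covers w = v.\<close>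
      define e where "e = r / (norm (w - v) + 1)"
      have e: "e > 0" using r by (simp add: e_def add_nonneg_pos)
      let ?x = "w + e *\<^sub>R (w - v)"
      have "e * norm (w - v) \<le> e * (norm (w - v) + 1)" using e by simp
      also have "\<dots> = r" unfolding e_def by (simp add: add_nonneg_eq_0_iff)
      finally have "norm (e *\<^sub>R (w - v)) \<le> r" using e by simp
      then have "?x \<in> cball w r" by (simp add: dist_norm)
      then have x: "?f ?x \<in> Y" using r(2) by auto
      have ne: "1 + e \<noteq> 0" using e by simp
      have "w = (1 - e / (1 + e)) *\<^sub>R ?x + (e / (1 + e)) *\<^sub>R v"
      proof -
        have "(1 + e) *\<^sub>R ((1 - e / (1 + e)) *\<^sub>R ?x + (e / (1 + e)) *\<^sub>R v) = ?x + e *\<^sub>R v"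
          using ne by (simp add: scaleR_add_right field_simps)
        also have "\<dots> = (1 + e) *\<^sub>R w" by (simp add: algebra_simps)
        finally show ?thesis using ne by (simp only: scaleR_cancel_left) simp
      qed
      then have "?f w = (1 - e / (1 + e)) *\<^sub>R ?f ?x + (e / (1 + e)) *\<^sub>R q"
        unfolding v by (metis aff)
      also have "\<dots> = ?f ?x - (e / (1 + e)) *\<^sub>R (?f ?x - q)" by (simp add: algebra_simps)
      also have "\<dots> \<in> interior Y"
        by (rule mem_interior_convex_shrink[OF Y(2) q(1) x]) (use e in auto)
      finally show False using w by (simp add: frontier_def)
    qed
    moreover have "w \<in> closure ?K" by (rule closure_subset[THEN subsetD]) (use wY in simp)
    ultimately show ?thesis by (simp add: frontier_def)
  qed
  then have "{w. ?f w \<in> frontier Y} \<subseteq> frontier ?K" by auto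
  with K have "negligible {w. ?f w \<in> frontier Y}"
    using negligible_convex_frontier negligible_subset by metis
  from AE_lborel_notin_negligible[OF this] show ?thesis by simp
qed

end

section \<open>Laguerre cells and dual optimality\<close>

text \<open>Cells are the regions where one of these functions is minimal, and passing from z to z +
  h lowers the i-th one by \<open>h $ i\<close>. Comparisons of cells thus become linear
  arithmetic.\<close>

definition pot :: "('n::finite \<Rightarrow> 'a::euclidean_space) \<Rightarrow> real^'n \<Rightarrow> 'n \<Rightarrow> 'a \<Rightarrow> real" where
  "pot x z i y = (norm (y - x i))\<^sup>2 / 2 - z $ i"

lemma pot_diff: "pot x z j y - pot x z i y = inner (x i - x j) y - b_coef x z i j"
proof -
  have sq: "(norm (y - a))\<^sup>2 = (norm y)\<^sup>2 - 2 * inner a y + (norm a)\<^sup>2" for a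
    using dot_norm_neg[of a y] by (simp add: norm_minus_commute field_simps)
  show ?thesis
    unfolding pot_def b_coef_def sq by (simp add: inner_diff_left field_simps)
qed

lemma laguerre_cell_iff: "y \<in> laguerre_cell x z i \<longleftrightarrow> (\<forall>j. pot x z i y \<le> pot x z j y)"
proof -
  have "inner (x i - x j) y \<ge> b_coef x z i j \<longleftrightarrow> pot x z i y \<le> pot x z j y" for j
    using pot_diff[of x z j y i] by linarith
  then show ?thesis unfolding laguerre_cell_def by auto
qed

lemma closed_laguerre_cell: "closed (laguerre_cell x z i)"
  unfolding laguerre_cell_def by (intro closed_INT ballI closed_halfspace_ge)

lemma laguerre_cell_borel [measurable]: "laguerre_cell x z i \<in> sets borel"
  by (rule borel_closed[OF closed_laguerre_cell])

lemma laguerre_cell_exists: "\<exists>i. y \<in> laguerre_cell x z i"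
proof -
  obtain i where "is_arg_min (\<lambda>i. pot x z i y) (\<lambda>i. i \<in> UNIV) i"
    using ex_is_arg_min_if_finite[of UNIV "\<lambda>i. pot x z i y"] by auto
  then show ?thesis unfolding laguerre_cell_iff is_arg_min_linorder by auto
qed

lemma transport_map_cell: "\<exists>i. transport_map x z y = x i \<and> y \<in> laguerre_cell x z i"
proof -
  let ?i = "SOME i. \<forall>j. pot x z i y \<le> pot x z j y"
  have "\<exists>i. \<forall>j. pot x z i y \<le> pot x z j y"
    using laguerre_cell_exists unfolding laguerre_cell_iff by blast
  from someI_ex[OF this] have "y \<in> laguerre_cell x z ?i" unfolding laguerre_cell_iff .
  moreover have "transport_map x z y = x ?i" unfolding transport_map_def pot_def ..
  ultimately show ?thesis by blast
qed

lemma borel_measurable_pot [measurable]: "pot x z i \<in> borel_measurable borel"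
  unfolding pot_def[abs_def] by measurable

text \<open>Measurability of a Hilbert choice: the chosen site depends on y only through the set of
  minimising indices, which takes finitely many values.\<close>

lemma transport_map_eq_choice:
  "transport_map x z = (\<lambda>S. x (SOME i. i \<in> S)) \<circ> (\<lambda>y. {i. y \<in> laguerre_cell x z i})"
proof (rule ext)
  fix y
  show "transport_map x z y = ((\<lambda>S. x (SOME i. i \<in> S)) \<circ> (\<lambda>y. {i. y \<in> laguerre_cell x z i})) y"
    unfolding o_def mem_Collect_eq laguerre_cell_iff unfolding transport_map_def pot_def by (rule refl)
qed

lemma measurable_cell_indices:
  fixes x :: "'n::finite \<Rightarrow> 'a::euclidean_space"
  shows "(\<lambda>y. {i. y \<in> laguerre_cell x z i}) \<in> borel \<rightarrow>\<^sub>M count_space UNIV"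
  unfolding measurable_count_space_eq2[OF finite]
proof (intro conjI ballI)
  fix S :: "'n set"
  have "(\<lambda>y. {i. y \<in> laguerre_cell x z i}) -` {S}
      = (\<Inter>i. if i \<in> S then laguerre_cell x z i else - laguerre_cell x z i)"
    by (auto split: if_splits)
  also have "\<dots> \<in> sets borel" by (intro sets.countable_INT'') auto
  finally show "(\<lambda>y. {i. y \<in> laguerre_cell x z i}) -` {S} \<inter> space borel \<in> sets borel" by simp
qed simp

lemma borel_measurable_transport_map [measurable]: "transport_map x z \<in> borel_measurable borel"
  unfolding transport_map_eq_choice by (rule measurable_comp[OF measurable_cell_indices]) simp

lemma AE_pot_distinct:
  assumes "inj x"
  shows "AE y in lborel. \<forall>i j. i \<noteq> j \<longrightarrow> pot x z i y \<noteq> pot x z j y"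
proof -
  have "AE y in lborel. i \<noteq> j \<longrightarrow> pot x z i y \<noteq> pot x z j y" for i j
  proof (cases "i = j")
    case False
    then have "x i - x j \<noteq> 0" using assms by (simp add: inj_eq)
    then have "negligible {y. inner (x i - x j) y = b_coef x z i j}"
      by (intro negligible_hyperplane) auto
    from AE_lborel_notin_negligible[OF this] show ?thesis
      using pot_diff[of x z j _ i] by (elim eventually_mono) (auto, smt (verit))
  qed simp
  then show ?thesis by (intro eventually_all_finite)
qed

locale dual_optimum =
  fixes x :: "'n::finite \<Rightarrow> 'a::euclidean_space"
    and p :: "'n \<Rightarrow> real" and R :: "'a measure" and \<rho> :: "'a \<Rightarrow> real" and Y :: "'a set"
    and \<phi> :: "'a \<Rightarrow> 'a" and z :: "real^'n"
  assumes x_inj: "inj x" and p_pos: "\<And>i. p i > 0"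
    and R_density: "R = density lborel (\<lambda>y. ennreal (\<rho> y))"
    and R_prob: "prob_space R"
    and rho_meas [measurable]: "\<rho> \<in> borel_measurable borel"
    and rho_nonneg: "\<And>y. \<rho> y \<ge> 0"
    and Y_compact: "compact Y" and Y_convex: "convex Y"
    and rho_cont: "continuous_on Y \<rho>"
    and rho_zero: "\<And>y. y \<notin> Y \<Longrightarrow> \<rho> y = 0"
    and phi_meas [measurable]: "\<phi> \<in> borel_measurable borel"
    and phi_bounded: "bounded (range \<phi>)"
    and phi_disc: "hausdorff_dimension {y. \<not> isCont \<phi> y} < real DIM('a) - 1"
    and z_opt: "\<And>z'. dual_obj x p R z' \<le> dual_obj x p R z"
begin

sublocale R: prob_space R by (rule R_prob)

lemma sets_R [measurable_cong, simp]: "sets R = sets borel"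
  by (simp add: R_density)

lemma AE_R_in_Y: "AE y in R. y \<in> Y"
proof -
  have "0 < ennreal (\<rho> y) \<longrightarrow> y \<in> Y" for y using rho_zero[of y] by (cases "y \<in> Y") auto
  then show ?thesis unfolding R_density by (subst AE_density) simp_all
qed

lemma rho_bounded: obtains M where "\<And>y. \<rho> y \<le> M" "M \<ge> 0"
proof -
  have "bounded (\<rho> ` Y)" by (intro compact_imp_bounded compact_continuous_image rho_cont Y_compact)
  then obtain M where "M > 0" "\<And>y. y \<in> Y \<Longrightarrow> \<rho> y \<le> M" by (force simp: bounded_pos)
  then have "\<rho> y \<le> M" for y using rho_zero[of y] by (cases "y \<in> Y") auto
  then show ?thesis using that[of M] \<open>M > 0\<close> by simp
qed

lemma integrable_pot: "integrable R (pot x z' i)"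
proof -
  have "bounded (pot x z' i ` Y)"
    unfolding pot_def
    by (intro compact_imp_bounded compact_continuous_image continuous_intros Y_compact) simp
  then obtain B where "\<And>y. y \<in> Y \<Longrightarrow> norm (pot x z' i y) \<le> B" by (force simp: bounded_iff)
  then have "AE y in R. norm (pot x z' i y) \<le> B"
    using AE_R_in_Y by (elim eventually_mono) auto
  then show ?thesis by (intro R.integrable_const_bound) auto
qed

section \<open>Positive mass of the optimal cells\<close>

definition Mpot :: "real^'n \<Rightarrow> 'a \<Rightarrow> real" where
  "Mpot z' y = Min ((\<lambda>i. pot x z' i y) ` UNIV)"

lemma Mpot_le: "Mpot z' y \<le> pot x z' i y"
  unfolding Mpot_def by (rule Min_le) auto

lemma Mpot_attained: obtains i where "Mpot z' y = pot x z' i y" "y \<in> laguerre_cell x z' i"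
proof -
  have "Mpot z' y \<in> (\<lambda>i. pot x z' i y) ` UNIV" unfolding Mpot_def by (rule Min_in) auto
  then obtain i where "Mpot z' y = pot x z' i y" by auto
  with Mpot_le[of z' y] show ?thesis by (intro that[of i]) (auto simp: laguerre_cell_iff)
qed

lemma integrable_Mpot: "integrable R (Mpot z')"
proof (rule Bochner_Integration.integrable_bound)
  show "integrable R (\<lambda>y. \<Sum>i\<in>UNIV. \<bar>pot x z' i y\<bar>)"
    by (intro Bochner_Integration.integrable_sum integrable_abs integrable_pot)
  show "Mpot z' \<in> borel_measurable R"
    unfolding Mpot_def[abs_def] by (intro borel_measurable_Min) auto
  show "AE y in R. norm (Mpot z' y) \<le> norm (\<Sum>i\<in>UNIV. \<bar>pot x z' i y\<bar>)"
  proof (rule AE_I2)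
    fix y
    obtain i where "Mpot z' y = pot x z' i y" by (rule Mpot_attained)
    moreover have "\<bar>pot x z' i y\<bar> \<le> (\<Sum>i\<in>UNIV. \<bar>pot x z' i y\<bar>)"
      by (rule member_le_sum) auto
    ultimately show "norm (Mpot z' y) \<le> norm (\<Sum>i\<in>UNIV. \<bar>pot x z' i y\<bar>)" by simp
  qed
qed

lemma dual_obj_Mpot: "dual_obj x p R z' = (\<Sum>i\<in>UNIV. z' $ i * p i) + (\<integral>y. Mpot z' y \<partial>R)"
  by (simp add: dual_obj_def Mpot_def pot_def)

text \<open>Raising \<open>z $ i\<close> by \<open>t\<close> gains \<open>t * p i\<close> in the dual objective and costs at most \<open>t\<close> times the
  mass of the enlarged cell.\<close>
lemma p_le_measure_shifted_cell:
  assumes t: "t > 0"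
  shows "p i \<le> measure R (laguerre_cell x (z + axis i t) i)"
proof -
  let ?z = "z + axis i t"
  have le: "Mpot z y \<le> Mpot ?z y + t * indicator (laguerre_cell x ?z i) y" for y
  proof -
    obtain k where k: "Mpot ?z y = pot x ?z k y" "y \<in> laguerre_cell x ?z k" by (rule Mpot_attained)
    have "Mpot z y \<le> pot x z k y" by (rule Mpot_le)
    then show ?thesis using k t by (cases "k = i") (auto simp: pot_def axis_def indicator_def)
  qed
  have int: "integrable R (\<lambda>y. t * indicator (laguerre_cell x ?z i) y :: real)"
    by (intro integrable_mult_right R.integrable_const_bound[where B=1]) (auto simp: indicator_def)
  have "(\<integral>y. Mpot z y \<partial>R) \<le> (\<integral>y. Mpot ?z y + t * indicator (laguerre_cell x ?z i) y \<partial>R)"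
    by (intro integral_mono integrable_Mpot Bochner_Integration.integrable_add int le)
  also have "\<dots> = (\<integral>y. Mpot ?z y \<partial>R) + t * measure R (laguerre_cell x ?z i)"
    by (subst Bochner_Integration.integral_add[OF integrable_Mpot int]) simp
  finally have 1: "(\<integral>y. Mpot z y \<partial>R) \<le> (\<integral>y. Mpot ?z y \<partial>R) + t * measure R (laguerre_cell x ?z i)" .
  have "(\<Sum>k\<in>UNIV. ?z $ k * p k) = (\<Sum>k\<in>UNIV. z $ k * p k + (if k = i then t * p i else 0))"
    by (intro sum.cong) (auto simp: axis_def algebra_simps)
  also have "\<dots> = (\<Sum>k\<in>UNIV. z $ k * p k) + t * p i" by (simp add: sum.distrib)
  finally have "t * p i \<le> t * measure R (laguerre_cell x ?z i)"
    using 1 z_opt[of ?z] by (simp add: dual_obj_Mpot)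
  then show ?thesis using t by simp
qed

text \<open>The cells enlarged by t = 1 / (n+1) decrease to the cell of z, so the bound by
  \<open>p i\<close> survives in the limit.\<close>

lemma measure_cell_pos: "measure R (laguerre_cell x z i) > 0"
proof -
  define A where "A n = laguerre_cell x (z + axis i (1 / real (Suc n))) i" for n
  have A_iff: "y \<in> A n \<longleftrightarrow> (\<forall>j. j \<noteq> i \<longrightarrow> pot x z i y - 1 / real (Suc n) \<le> pot x z j y)" for y n
    unfolding A_def laguerre_cell_iff by (auto simp: pot_def axis_def algebra_simps)
  have dec: "decseq A"
    unfolding decseq_Suc_iff
  proof (intro allI subsetI)
    fix n y assume y: "y \<in> A (Suc n)"
    have "1 / real (Suc (Suc n)) \<le> 1 / real (Suc n)" by (simp add: field_simps)
    with y show "y \<in> A n" unfolding A_iff by force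
  qed
  have "(\<Inter>n. A n) = laguerre_cell x z i"
  proof (intro set_eqI iffI)
    fix y assume y: "y \<in> (\<Inter>n. A n)"
    have "pot x z i y \<le> pot x z j y" if "j \<noteq> i" for j
    proof (rule field_le_epsilon)
      fix e :: real assume "0 < e"
      then obtain n where n: "1 / real (Suc n) < e"
        using reals_Archimedean[of e] by (auto simp: inverse_eq_divide)
      have "y \<in> A n" using y by blast
      then have "pot x z i y - 1 / real (Suc n) \<le> pot x z j y" using that unfolding A_iff by blast
      then show "pot x z i y \<le> pot x z j y + e" using n by linarith
    qed
    then show "y \<in> laguerre_cell x z i" unfolding laguerre_cell_iff by (metis order_refl)
  next
    fix y assume y: "y \<in> laguerre_cell x z i"
    have "pot x z i y - 1 / real (Suc n) \<le> pot x z j y" for j n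
      using y unfolding laguerre_cell_iff by (smt (verit) divide_nonneg_nonneg of_nat_0_le_iff)
    then show "y \<in> (\<Inter>n. A n)" by (simp add: A_iff)
  qed
  moreover have "(\<lambda>n. measure R (A n)) \<longlonglongrightarrow> measure R (\<Inter>n. A n)"
    by (rule R.finite_Lim_measure_decseq[OF _ dec]) (auto simp: A_def)
  ultimately have "(\<lambda>n. measure R (A n)) \<longlonglongrightarrow> measure R (laguerre_cell x z i)" by simp
  then have "p i \<le> measure R (laguerre_cell x z i)"
  proof (rule LIMSEQ_le_const, intro exI allI impI)
    show "p i \<le> measure R (A n)" for n
      unfolding A_def by (rule p_le_measure_shifted_cell) simp
  qed
  then show ?thesis using p_pos[of i] by linarith
qed

lemma AE_notin_frontier_Y: "AE y in lborel. y \<notin> frontier Y"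
  by (rule AE_lborel_notin_negligible[OF negligible_convex_frontier[OF Y_convex]])

text \<open>R has a density that vanishes off Y, so a cell of positive mass meets the interior of Y
  outside any Lebesgue null set; P serves to avoid a hyperplane.\<close>

lemma cell_interior_point:
  assumes "AE y in lborel. P y"
  obtains y where "y \<in> laguerre_cell x z i" "y \<in> interior Y" "P y"
proof (rule ccontr)
  assume no: "\<not> thesis"
  have "AE y in lborel. y \<in> laguerre_cell x z i \<longrightarrow> \<rho> y = 0"
    using assms AE_notin_frontier_Y
  proof eventually_elim
    case (elim y)
    then show ?case using no that rho_zero[of y] compact_imp_closed[OF Y_compact]
      by (auto simp: frontier_def closure_closed)
  qed
  then have "AE y in lborel. ennreal (\<rho> y) * indicator (laguerre_cell x z i) y = 0"
    by (rule eventually_mono) (auto simp: indicator_def)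
  then have "(\<integral>\<^sup>+y. ennreal (\<rho> y) * indicator (laguerre_cell x z i) y \<partial>lborel) = (\<integral>\<^sup>+(y::'a). 0 \<partial>lborel)"
    by (rule nn_integral_cong_AE)
  then have "emeasure R (laguerre_cell x z i) = 0"
    unfolding R_density by (subst emeasure_density) auto
  then show False using measure_cell_pos[of i] by (simp add: measure_def)
qed

lemma AE_off_hyperplane:
  assumes "i \<noteq> j" shows "AE y in lborel. inner (x i - x j) y \<noteq> b_coef x z i j"
  using AE_pot_distinct[OF x_inj, of z]
proof (rule eventually_mono)
  fix y assume "\<forall>i j. i \<noteq> j \<longrightarrow> pot x z i y \<noteq> pot x z j y"
  then have "pot x z j y - pot x z i y \<noteq> 0" using assms by (metis eq_iff_diff_eq_0)
  then show "inner (x i - x j) y \<noteq> b_coef x z i j" unfolding pot_diff by simp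
qed

text \<open>If the three bisecting hyperplanes coincide, then the sites are collinear and the cell of the
  middle one is contained in the hyperplane.\<close>
lemma bisectors_not_coincident:
  assumes ne: "i \<noteq> j" "k \<noteq> i" "k \<noteq> j"
    and eq: "x i - x k = a *\<^sub>R (x i - x j)" "b_coef x z i k = a * b_coef x z i j"
  shows False
proof -
  define \<tau> where "\<tau> y = inner (x i - x j) y - b_coef x z i j" for y
  have j: "pot x z j y = pot x z i y + \<tau> y" for y
    using pot_diff[of x z j y i] by (simp add: \<tau>_def)
  have k: "pot x z k y = pot x z i y + a * \<tau> y" for y
    using pot_diff[of x z k y i] unfolding eq \<tau>_def by (simp add: algebra_simps)
  have a: "a \<noteq> 0" "a \<noteq> 1" using eq(1) ne x_inj by (auto simp: inj_eq)
  have off: "AE y in lborel. \<tau> y \<noteq> 0"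
    using AE_off_hyperplane[OF ne(1)] by (elim eventually_mono) (simp add: \<tau>_def)
  \<comment> \<open>Relative to \<open>pot x z i y\<close> the three potentials are 0,
    \<open>\<tau> y\<close> and \<open>a * \<tau> y\<close>. The index whose slope lies between the
    other two (i, k, j in the three cases) is never minimal where \<open>\<tau> y\<close> is
    nonzero, yet its cell has positive mass.\<close>
  consider "a < 0" | "0 < a" "a < 1" | "a > 1" using a by linarith
  then show False
  proof cases
    case 1
    obtain y where y: "y \<in> laguerre_cell x z i" "\<tau> y \<noteq> 0" using cell_interior_point[OF off] by metis
    then have "0 \<le> \<tau> y" "0 \<le> a * \<tau> y" unfolding laguerre_cell_iff using j k by (metis add_le_cancel_left add.right_neutral)+
    then show False using y(2) 1 by (simp add: zero_le_mult_iff)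
  next
    case 2
    obtain y where y: "y \<in> laguerre_cell x z k" "\<tau> y \<noteq> 0" using cell_interior_point[OF off] by metis
    then have "pot x z k y \<le> pot x z i y" "pot x z k y \<le> pot x z j y" unfolding laguerre_cell_iff by auto
    then have "a * \<tau> y \<le> 0" "0 \<le> (1 - a) * \<tau> y" unfolding j k by (auto simp: algebra_simps)
    then show False using y(2) 2 by (simp add: mult_le_0_iff zero_le_mult_iff)
  next
    case 3
    obtain y where y: "y \<in> laguerre_cell x z j" "\<tau> y \<noteq> 0" using cell_interior_point[OF off] by metis
    then have "pot x z j y \<le> pot x z i y" "pot x z j y \<le> pot x z k y" unfolding laguerre_cell_iff by auto
    then have "\<tau> y \<le> 0" "0 \<le> (a - 1) * \<tau> y" unfolding j k by (auto simp: algebra_simps)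
    then show False using y(2) 3 by (simp add: zero_le_mult_iff)
  qed
qed

text \<open>Both cells contain interior points of Y, and these lie on opposite closed sides of the
  hyperplane; the interior of Y is connected.\<close>

lemma interior_point_on_bisector:
  assumes "i \<noteq> j"
  obtains q where "q \<in> interior Y" "inner (x i - x j) q = b_coef x z i j"
proof -
  obtain q1 where q1: "q1 \<in> laguerre_cell x z i" "q1 \<in> interior Y" by (rule cell_interior_point[of "\<lambda>_. True"]) auto
  obtain q2 where q2: "q2 \<in> laguerre_cell x z j" "q2 \<in> interior Y" by (rule cell_interior_point[of "\<lambda>_. True"]) auto
  have 1: "b_coef x z i j \<le> inner (x i - x j) q1"
    using q1(1) pot_diff[of x z j q1 i] unfolding laguerre_cell_iff by (smt (verit))
  have 2: "inner (x i - x j) q2 \<le> b_coef x z i j"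
    using q2(1) pot_diff[of x z j q2 i] unfolding laguerre_cell_iff by (smt (verit))
  have "connected (interior Y)" by (intro convex_connected convex_interior Y_convex)
  from connected_ivt_hyperplane[OF this q2(2) q1(2) 2 1] show ?thesis using that by auto
qed

end

section \<open>Mass exchanged between cells\<close>

lemma pot_add: "pot x (z + h) k y = pot x z k y - h $ k"
  by (simp add: pot_def)

lemma AE_lborel_fst:
  assumes "AE w in (lborel :: 'b::euclidean_space measure). P w"
  shows "AE q in (lborel :: ('b \<times> 'c::euclidean_space) measure). P (fst q)"
proof -
  obtain N where N: "{w. \<not> P w} \<subseteq> N" "N \<in> null_sets lborel"
    using assms by (auto elim!: AE_E simp: null_sets_def)
  have "N \<times> (UNIV :: 'c set) \<in> null_sets (lborel \<Otimes>\<^sub>M lborel)"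
    using N(2) by (intro null_setsI) (auto simp: lborel.emeasure_pair_measure_Times null_sets_def)
  then show ?thesis
    unfolding lborel_prod[symmetric] by (rule AE_I') (use N(1) in auto)
qed

lemma eventually_less_of_tendsto:
  fixes a b :: real
  assumes "(f \<longlongrightarrow> a) F" "(g \<longlongrightarrow> b) F" "a < b"
  shows "eventually (\<lambda>n. f n < g n) F"
proof -
  have "eventually (\<lambda>n. 0 < g n - f n) F"
    using assms by (intro order_tendstoD(1)[OF tendsto_diff[OF assms(2,1)]]) simp
  then show ?thesis by (rule eventually_mono) simp
qed

context dual_optimum
begin

definition flux_density :: "'n \<Rightarrow> 'n \<Rightarrow> 'a \<Rightarrow> real" where
  "flux_density i j y = inner (x i - x j) (\<phi> y) * \<rho> y"

text \<open>Contribution of the points that belong to j for z and to i for z + h: the first index is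
  the new owner.\<close>

definition exchange :: "'n \<Rightarrow> 'n \<Rightarrow> real^'n \<Rightarrow> real" where
  "exchange i j h = (\<integral>y. indicator (laguerre_cell x (z + h) i \<inter> laguerre_cell x z j) y * flux_density i j y \<partial>lborel)"

definition interface :: "'n \<Rightarrow> 'n \<Rightarrow> real" where
  "interface i j = (\<integral>y. indicator (laguerre_cell x z i \<inter> laguerre_cell x z j) y * flux_density i j y
      \<partial>hausdorff_measure (real DIM('a) - 1))"

lemma borel_measurable_flux_density [measurable]: "flux_density i j \<in> borel_measurable borel"
  unfolding flux_density_def[abs_def] by measurable

lemma flux_density_eq_0: "y \<notin> Y \<Longrightarrow> flux_density i j y = 0"
  by (simp add: flux_density_def rho_zero)

lemma flux_density_bounded: obtains M where "\<And>y. \<bar>flux_density i j y\<bar> \<le> M" "M \<ge> 0"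
proof -
  obtain M where M: "\<And>y. \<rho> y \<le> M" "M \<ge> 0" by (rule rho_bounded) blast
  obtain B where B: "\<And>y. norm (\<phi> y) \<le> B" using phi_bounded by (auto simp: bounded_iff)
  have B0: "B \<ge> 0" using B[of undefined] norm_ge_zero order_trans by blast
  have "\<bar>flux_density i j y\<bar> \<le> norm (x i - x j) * B * M" for y
  proof -
    have "\<bar>inner (x i - x j) (\<phi> y)\<bar> \<le> norm (x i - x j) * B"
      using Cauchy_Schwarz_ineq2[of "x i - x j" "\<phi> y"] B[of y]
      by (meson mult_left_mono norm_ge_zero order_trans)
    then show ?thesis
      unfolding flux_density_def abs_mult using M(1)[of y] rho_nonneg[of y] B0
      by (intro mult_mono) auto
  qed
  then show ?thesis using B0 M by (intro that[of "norm (x i - x j) * B * M"]) auto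
qed

lemma integrable_exchange:
  "integrable lborel (\<lambda>y. indicator (laguerre_cell x (z + h) i \<inter> laguerre_cell x z j) y * flux_density i j y)"
proof -
  obtain M where M: "\<And>y. \<bar>flux_density i j y\<bar> \<le> M" "M \<ge> 0" by (rule flux_density_bounded[of i j]) blast
  show ?thesis
  proof (rule Bochner_Integration.integrable_bound)
    show "integrable lborel (\<lambda>y. M * indicator Y y)"
      using Y_compact
      by (intro integrable_mult_right integrable_real_indicator emeasure_compact_finite)
         (auto intro: borel_compact)
    show "AE y in lborel. norm (indicator (laguerre_cell x (z + h) i \<inter> laguerre_cell x z j) y * flux_density i j y)
        \<le> norm (M * indicator Y y)"
      using M by (intro AE_I2) (auto simp: indicator_def flux_density_eq_0)
  qed measurable
qed

lemma interface_swap: "interface j i = - interface i j"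
proof -
  have "interface j i = (\<integral>y. - (indicator (laguerre_cell x z i \<inter> laguerre_cell x z j) y * flux_density i j y)
      \<partial>hausdorff_measure (real DIM('a) - 1))"
    unfolding interface_def
    by (intro Bochner_Integration.integral_cong) (auto simp: flux_density_def indicator_def inner_diff_left algebra_simps)
  then show ?thesis by (simp add: interface_def)
qed

text \<open>Continuity on Y is full continuity in its interior, and off Y the density vanishes on an
  open set; jumps can occur only across the frontier.\<close>

lemma isCont_rho: "isCont \<rho> y" if "y \<notin> frontier Y"
proof (cases "y \<in> Y")
  case True
  then have "y \<in> interior Y" using that closure_subset unfolding frontier_def by blast
  then show ?thesis using rho_cont continuous_on_interior by blast
next
  case False
  have "open (- Y)" using Y_compact by (simp add: compact_imp_closed open_Compl)
  then have "eventually (\<lambda>y. \<rho> y = 0) (nhds y)"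
    using False rho_zero by (auto simp: eventually_nhds)
  then show ?thesis using rho_zero[OF False] unfolding isCont_def
    by (intro tendsto_eventually) (auto simp: eventually_at_filter elim: eventually_mono)
qed

text \<open>A change from j to i requires i to gain on j. If it does not, only points tied between i
  and j remain, and these form a hyperplane.\<close>

lemma exchange_eq_0:
  assumes ij: "i \<noteq> j" and h: "h $ i \<le> h $ j"
  shows "exchange i j h = 0"
proof -
  have "AE y in lborel. indicator (laguerre_cell x (z + h) i \<inter> laguerre_cell x z j) y * flux_density i j y = 0"
    using AE_pot_distinct[OF x_inj, of z]
  proof (rule eventually_mono)
    fix y assume ne: "\<forall>i j. i \<noteq> j \<longrightarrow> pot x z i y \<noteq> pot x z j y"
    have "y \<notin> laguerre_cell x (z + h) i \<inter> laguerre_cell x z j"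
    proof
      assume "y \<in> laguerre_cell x (z + h) i \<inter> laguerre_cell x z j"
      then have "pot x z i y - h $ i \<le> pot x z j y - h $ j" "pot x z j y \<le> pot x z i y"
        by (auto simp: laguerre_cell_iff pot_add)
      then have "pot x z i y = pot x z j y" using h by linarith
      then show False using ne ij by blast
    qed
    then show "indicator (laguerre_cell x (z + h) i \<inter> laguerre_cell x z j) y * flux_density i j y = 0" by simp
  qed
  then show ?thesis unfolding exchange_def by (rule integral_eq_zero_AE)
qed

lemma exchange_self: "exchange i i h = 0"
  by (simp add: exchange_def flux_density_def)

text \<open>Almost every point lies in exactly one cell for z and in exactly one for z + h, so a
  single term of the double sum survives. The selection made on ties does not matter for the same
  reason.\<close>

lemma gamma_diff: "gamma_phi x R \<phi> (z + h) - gamma_phi x R \<phi> z = (\<Sum>i\<in>UNIV. \<Sum>j\<in>UNIV. exchange i j h)"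
proof -
  obtain B where B: "\<And>y. norm (\<phi> y) \<le> B" using phi_bounded by (auto simp: bounded_iff)
  have int: "integrable R (\<lambda>y. inner (\<phi> y) (transport_map x z' y))" for z'
  proof (rule R.integrable_const_bound)
    let ?C = "\<Sum>i\<in>UNIV. norm (x i)"
    show "AE y in R. norm (inner (\<phi> y) (transport_map x z' y)) \<le> B * ?C"
    proof (rule AE_I2)
      fix y
      obtain i where "transport_map x z' y = x i" using transport_map_cell by blast
      moreover have "norm (x i) \<le> ?C" by (rule member_le_sum) auto
      ultimately have "norm (transport_map x z' y) \<le> ?C" by simp
      moreover have "B \<ge> 0" using B[of undefined] norm_ge_zero order_trans by blast
      ultimately have "norm (\<phi> y) * norm (transport_map x z' y) \<le> B * ?C"
        using B[of y] by (intro mult_mono) auto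
      then show "norm (inner (\<phi> y) (transport_map x z' y)) \<le> B * ?C"
        using Cauchy_Schwarz_ineq2[of "\<phi> y" "transport_map x z' y"] by simp
    qed
  qed measurable
  have "gamma_phi x R \<phi> (z + h) - gamma_phi x R \<phi> z
      = (\<integral>y. inner (\<phi> y) (transport_map x (z + h) y) - inner (\<phi> y) (transport_map x z y) \<partial>R)"
    unfolding gamma_phi_def by (rule Bochner_Integration.integral_diff[OF int int, symmetric])
  also have "\<dots> = (\<integral>y. \<rho> y *\<^sub>R (inner (\<phi> y) (transport_map x (z + h) y) - inner (\<phi> y) (transport_map x z y)) \<partial>lborel)"
    unfolding R_density by (rule integral_density) (auto simp: rho_nonneg)
  also have "\<dots> = (\<integral>y. (\<Sum>i\<in>UNIV. \<Sum>j\<in>UNIV.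
      indicator (laguerre_cell x (z + h) i \<inter> laguerre_cell x z j) y * flux_density i j y) \<partial>lborel)"
  proof (rule integral_cong_AE)
    show "AE y in lborel. \<rho> y *\<^sub>R (inner (\<phi> y) (transport_map x (z + h) y) - inner (\<phi> y) (transport_map x z y))
        = (\<Sum>i\<in>UNIV. \<Sum>j\<in>UNIV. indicator (laguerre_cell x (z + h) i \<inter> laguerre_cell x z j) y * flux_density i j y)"
      using AE_pot_distinct[OF x_inj, of z] AE_pot_distinct[OF x_inj, of "z + h"]
    proof eventually_elim
      case (elim y)
      obtain a where a: "transport_map x (z + h) y = x a" "y \<in> laguerre_cell x (z + h) a"
        using transport_map_cell by blast
      obtain b where b: "transport_map x z y = x b" "y \<in> laguerre_cell x z b"
        using transport_map_cell by blast
      have a': "y \<in> laguerre_cell x (z + h) i \<longleftrightarrow> i = a" for i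
        using a(2) elim(2) unfolding laguerre_cell_iff by (metis order_antisym)
      have b': "y \<in> laguerre_cell x z j \<longleftrightarrow> j = b" for j
        using b(2) elim(1) unfolding laguerre_cell_iff by (metis order_antisym)
      have "(\<Sum>i\<in>UNIV. \<Sum>j\<in>UNIV. indicator (laguerre_cell x (z + h) i \<inter> laguerre_cell x z j) y * flux_density i j y)
          = (\<Sum>i\<in>UNIV. \<Sum>j\<in>UNIV. if j = b then (if i = a then flux_density a b y else 0) else 0)"
        by (intro sum.cong) (auto simp: indicator_def a' b')
      also have "\<dots> = flux_density a b y" by simp
      finally have sum: "(\<Sum>i\<in>UNIV. \<Sum>j\<in>UNIV. indicator (laguerre_cell x (z + h) i \<inter> laguerre_cell x z j) y * flux_density i j y)
          = flux_density a b y" .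
      show ?case
        unfolding sum a(1) b(1) by (simp add: flux_density_def inner_diff_right inner_diff_left inner_commute[of "\<phi> y"] algebra_simps)
    qed
  qed measurable
  also have "\<dots> = (\<Sum>i\<in>UNIV. \<integral>y. (\<Sum>j\<in>UNIV.
      indicator (laguerre_cell x (z + h) i \<inter> laguerre_cell x z j) y * flux_density i j y) \<partial>lborel)"
    by (rule Bochner_Integration.integral_sum) (intro Bochner_Integration.integrable_sum integrable_exchange)
  also have "\<dots> = (\<Sum>i\<in>UNIV. \<Sum>j\<in>UNIV. exchange i j h)"
    unfolding exchange_def by (intro sum.cong refl Bochner_Integration.integral_sum integrable_exchange)
  finally show ?thesis .
qed

end

locale bisector_chart = dual_optimum x p R \<rho> Y \<phi> z + hyperplane_chart L "(x i - x j) /\<^sub>R norm (x i - x j)"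
  for x :: "'n::finite \<Rightarrow> 'a::euclidean_space" and p R \<rho> Y \<phi> z
    and L :: "'b::euclidean_space \<Rightarrow> 'a" and i j +
  assumes ij: "i \<noteq> j"
begin

definition u :: 'a where "u = (x i - x j) /\<^sub>R norm (x i - x j)"
definition d :: real where "d = norm (x i - x j)"
definition c :: real where "c = b_coef x z i j / d"
text \<open>Isometric parametrisation of the bisecting hyperplane, c being its height along
  u.\<close>

definition f :: "'b \<Rightarrow> 'a" where "f w = L w + c *\<^sub>R u"

lemmas chart_facts = lin nrm rng[folded u_def] unit[folded u_def] orth[folded u_def] uu[folded u_def]
  inner_chart[folded u_def] norm_chart[folded u_def]

lemma d_pos: "d > 0"
  using ij x_inj by (auto simp: d_def inj_eq)

lemma x_diff: "x i - x j = d *\<^sub>R u"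
  using d_pos by (simp add: u_def d_def)

lemma pot_diff_chart: "pot x z j (L w + t *\<^sub>R u) - pot x z i (L w + t *\<^sub>R u) = d * (t - c)"
  using d_pos inner_chart[folded u_def, of w t]
  unfolding pot_diff x_diff by (simp add: c_def field_simps)

lemma pot_eq_f: "pot x z j (f w) = pot x z i (f w)"
  using pot_diff_chart[of w c] by (simp add: f_def)

lemma dist_f: "dist (f w) (f w') = dist w w'"
  using dist_slice[folded u_def] by (simp add: f_def)

lemma range_f: "range f = {y. inner (x i - x j) y = b_coef x z i j}"
  unfolding f_def[abs_def] range_slice[folded u_def] x_diff using d_pos by (auto simp: c_def field_simps)

lemma range_f_borel: "range f \<in> sets borel"
  unfolding range_f by (intro borel_closed closed_hyperplane)

lemma borel_measurable_f [measurable]: "f \<in> borel_measurable borel"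
  by (rule borel_measurable_isometry[OF dist_f])

lemma dim_b: "real DIM('b) = real DIM('a) - 1"
  using dim by simp

text \<open>The isometry pulls the discontinuities back to a set of full-dimensional Hausdorff outer
  measure 0, which lies in a Lebesgue null set.\<close>

lemma AE_f_isCont_phi: "AE w in lborel. isCont \<phi> (f w)"
proof -
  let ?W = "{w. \<not> isCont \<phi> (f w)}"
  have "hausdorff_outer (real DIM('b)) ?W = hausdorff_outer (real DIM('b)) (f ` ?W)"
    by (rule hausdorff_outer_isometry[OF _ dist_f, symmetric]) simp
  also have "\<dots> \<le> hausdorff_outer (real DIM('b)) {y. \<not> isCont \<phi> y}"
    by (rule hausdorff_outer_mono) auto
  also have "\<dots> = 0"
    unfolding dim_b by (rule hausdorff_dimension_less(2)[OF phi_disc])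
  finally have "hausdorff_outer (real DIM('b)) ?W = 0" by simp
  then obtain N where "N \<in> null_sets lborel" "?W \<subseteq> N" by (rule hausdorff_outer_zero_null_sets)
  then show ?thesis by (auto intro: AE_I')
qed

lemma AE_f_notin_frontier: "AE w in lborel. f w \<notin> frontier Y"
proof -
  obtain q where q: "q \<in> interior Y" "inner (x i - x j) q = b_coef x z i j"
    by (rule interior_point_on_bisector[OF ij])
  have "inner u q = c" using q(2) d_pos unfolding x_diff by (simp add: c_def field_simps)
  with q(1) Y_compact Y_convex show ?thesis
    unfolding f_def using AE_slice_notin_frontier[folded u_def, of Y q c] by (simp add: compact_imp_closed)
qed

lemma AE_f_isCont_flux: "AE w in lborel. isCont (flux_density i j) (f w)"
  using AE_f_isCont_phi AE_f_notin_frontier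
proof eventually_elim
  case (elim w)
  then show ?case
    unfolding flux_density_def[abs_def] by (intro continuous_intros isCont_rho) auto
qed

text \<open>In the chart a tie of i with k is one affine equation in w. Its solutions are negligible
  unless it reads 0 = 0, and then the bisector of i and k is that of i and j.\<close>

lemma AE_f_no_third_cell: "AE w in lborel. \<forall>k. k \<noteq> i \<longrightarrow> k \<noteq> j \<longrightarrow> pot x z k (f w) \<noteq> pot x z i (f w)"
proof (rule eventually_all_finite)
  fix k
  show "AE w in lborel. k \<noteq> i \<longrightarrow> k \<noteq> j \<longrightarrow> pot x z k (f w) \<noteq> pot x z i (f w)"
  proof (cases "k = i \<or> k = j")
    case False
    let ?a = "x i - x k"
    let ?b = "b_coef x z i k - c * inner ?a u"
    have iff: "pot x z k (f w) = pot x z i (f w) \<longleftrightarrow> inner (adjoint L ?a) w = ?b" for w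
    proof -
      have "inner ?a (f w) = inner (adjoint L ?a) w + c * inner ?a u"
        using adjoint_works[OF lin, of w ?a] by (simp add: f_def inner_add_right inner_commute)
      then show ?thesis using pot_diff[of x z k "f w" i] by auto
    qed
    have "adjoint L ?a \<noteq> 0 \<or> ?b \<noteq> 0"
    proof (rule ccontr)
      assume "\<not> ?thesis"
      then have a0: "adjoint L ?a = 0" and b0: "?b = 0" by auto
      have La: "inner ?a (L w) = 0" for w
        using adjoint_works[OF lin, of w ?a] a0 by (simp add: inner_commute)
      \<comment> \<open>The part of x i - x k orthogonal to u lies in the range of L and is
        orthogonal to it, so it vanishes.\<close>
      let ?r = "?a - inner u ?a *\<^sub>R u"
      obtain w where w: "?a = L w + inner u ?a *\<^sub>R u" by (rule chart_exists[folded u_def])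
      then have "?r = L w" by (simp add: algebra_simps)
      then have "inner ?r ?r = inner ?a (L w) - inner u ?a * inner u (L w)"
        by (metis inner_diff_left inner_scaleR_left)
      then have "?r = 0" using La[of w] chart_facts(5) by simp
      then have a: "?a = (inner u ?a / d) *\<^sub>R (x i - x j)"
        unfolding x_diff using d_pos by simp
      have "b_coef x z i k = (inner u ?a / d) * b_coef x z i j"
        using b0 d_pos by (simp add: c_def inner_commute)
      from bisectors_not_coincident[OF ij _ _ a this] False show False by auto
    qed
    then have "negligible {w. inner (adjoint L ?a) w = ?b}" by (rule negligible_hyperplane)
    from AE_lborel_notin_negligible[OF this] show ?thesis by (simp add: iff)
  qed auto
qed

lemma interface_chart:
  "interface i j = (\<integral>w. indicator (laguerre_cell x z i \<inter> laguerre_cell x z j) (f w) * flux_density i j (f w) \<partial>lborel)"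
  unfolding interface_def dim_b[symmetric]
proof (rule integral_hausdorff_measure_isometry[OF dist_f range_f_borel])
  fix y assume y: "y \<notin> range f"
  have "pot x z j y - pot x z i y \<noteq> 0" using y unfolding range_f pot_diff by simp
  then have "y \<notin> laguerre_cell x z i \<inter> laguerre_cell x z j"
    unfolding laguerre_cell_iff Int_iff by (smt (verit))
  then show "indicator (laguerre_cell x z i \<inter> laguerre_cell x z j) y * flux_density i j y = 0" by simp
qed measurable

text \<open>The depth below the hyperplane, towards x j, is measured in units of the slab width (h i
  - h j) / d, so the slab is \<open>snd q \<in> {0..1}\<close> for every h.\<close>

definition scaled_point :: "real^'n \<Rightarrow> 'b \<times> real \<Rightarrow> 'a" where
  "scaled_point h q = L (fst q) + (c - (h $ i - h $ j) / d * snd q) *\<^sub>R u"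

definition scaled_integrand :: "real^'n \<Rightarrow> 'b \<times> real \<Rightarrow> real" where
  "scaled_integrand h q = indicator (laguerre_cell x (z + h) i \<inter> laguerre_cell x z j) (scaled_point h q)
     * flux_density i j (scaled_point h q)"

text \<open>Constant in the normal coordinate over an interval of length 1, so it integrates to the
  interface integral.\<close>

definition limit_integrand :: "'b \<times> real \<Rightarrow> real" where
  "limit_integrand q = indicator {0..1} (snd q) *
     (indicator (laguerre_cell x z i \<inter> laguerre_cell x z j) (f (fst q)) * flux_density i j (f (fst q)))"

lemma borel_measurable_scaled_point [measurable]: "scaled_point h \<in> borel_measurable borel"
  unfolding scaled_point_def[abs_def]
  by (intro borel_measurable_continuous_onI continuous_chart[folded u_def] continuous_intros)

lemma borel_measurable_scaled_integrand [measurable]: "scaled_integrand h \<in> borel_measurable borel"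
  unfolding scaled_integrand_def[abs_def] by measurable

lemma borel_measurable_limit_integrand [measurable]: "limit_integrand \<in> borel_measurable borel"
proof -
  have [measurable]: "fst \<in> (borel :: ('b \<times> real) measure) \<rightarrow>\<^sub>M borel" "snd \<in> (borel :: ('b \<times> real) measure) \<rightarrow>\<^sub>M borel"
    by (intro borel_measurable_continuous_onI continuous_intros)+
  show ?thesis unfolding limit_integrand_def[abs_def] by measurable
qed

lemma exchange_scaled:
  assumes "h $ i > h $ j"
  shows "exchange i j h = (h $ i - h $ j) / d * (\<integral>q. scaled_integrand h q \<partial>lborel)"
  unfolding exchange_def scaled_integrand_def scaled_point_def
  by (rule integral_chart_scaled[folded u_def]) (use assms d_pos in auto)

lemma scaled_point_membership:
  assumes h: "h $ i > h $ j" and y: "y = scaled_point h q"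
  shows "pot x z j y - pot x z i y = - (h $ i - h $ j) * snd q"
  unfolding y scaled_point_def pot_diff_chart using d_pos by (simp add: field_simps)

lemma scaled_integrand_eq_0:
  assumes h: "h $ i > h $ j" and q: "snd q \<notin> {0..1}"
  shows "scaled_integrand h q = 0"
proof -
  let ?y = "scaled_point h q"
  have diff: "pot x z j ?y - pot x z i ?y = - (h $ i - h $ j) * snd q"
    by (rule scaled_point_membership[OF h refl])
  have "?y \<notin> laguerre_cell x (z + h) i \<inter> laguerre_cell x z j"
  proof
    assume "?y \<in> laguerre_cell x (z + h) i \<inter> laguerre_cell x z j"
    then have "pot x z i ?y - h $ i \<le> pot x z j ?y - h $ j" "pot x z j ?y \<le> pot x z i ?y"
      by (auto simp: laguerre_cell_iff pot_add)
    then have "0 \<le> (h $ i - h $ j) * snd q" "(h $ i - h $ j) * snd q \<le> (h $ i - h $ j) * 1"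
      using diff by (auto simp: algebra_simps)
    then have "0 \<le> snd q" "snd q \<le> 1" using h by (auto simp: zero_le_mult_iff)
    then show False using q by simp
  qed
  then show ?thesis by (simp add: scaled_integrand_def)
qed

text \<open>The chart preserves norms, so a point in the bounded set Y has first coordinate in a
  fixed ball, whatever h is. A constant on a compact cylinder dominates.\<close>

lemma scaled_integrand_dominated:
  obtains w where "integrable lborel w"
    "\<And>h q. h $ i > h $ j \<Longrightarrow> norm (scaled_integrand h q) \<le> w q"
proof -
  obtain M where M: "\<And>y. \<bar>flux_density i j y\<bar> \<le> M" "M \<ge> 0" by (rule flux_density_bounded[of i j]) blast
  obtain B where B: "\<And>y. y \<in> Y \<Longrightarrow> norm y \<le> B"
    using compact_imp_bounded[OF Y_compact] by (auto simp: bounded_iff)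
  let ?K = "cball 0 B \<times> {0..1} :: ('b \<times> real) set"
  have K: "compact ?K" by (intro compact_Times) auto
  show ?thesis
  proof (rule that[of "\<lambda>q. M * indicator ?K q"])
    show "integrable lborel (\<lambda>q. M * indicator ?K q)"
      using K by (intro integrable_mult_right integrable_real_indicator emeasure_compact_finite)
        (auto intro: borel_compact)
    fix h :: "real^'n" and q assume h: "h $ i > h $ j"
    show "norm (scaled_integrand h q) \<le> M * indicator ?K q"
    proof (cases "scaled_integrand h q = 0")
      case False
      then have "snd q \<in> {0..1}" using scaled_integrand_eq_0[OF h] by blast
      moreover have "scaled_point h q \<in> Y"
        using False flux_density_eq_0 by (auto simp: scaled_integrand_def)
      then have "norm (L (fst q) + (c - (h $ i - h $ j) / d * snd q) *\<^sub>R u) \<le> B"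
        using B by (simp add: scaled_point_def)
      then have "norm (fst q) \<le> B"
        unfolding chart_facts(8) using norm_fst_le order_trans by blast
      ultimately have "q \<in> ?K" by (cases q) auto
      then show ?thesis using M by (auto simp: scaled_integrand_def indicator_def)
    qed (use M in \<open>auto simp: indicator_def\<close>)
  qed
qed

lemma scaled_point_tendsto:
  assumes "h \<longlonglongrightarrow> 0" shows "(\<lambda>n. scaled_point (h n) q) \<longlonglongrightarrow> f (fst q)"
proof -
  have "(\<lambda>n. L (fst q) + (c - (h n $ i - h n $ j) / d * snd q) *\<^sub>R u)
      \<longlonglongrightarrow> L (fst q) + (c - ((0::real^'n) $ i - (0::real^'n) $ j) / d * snd q) *\<^sub>R u"
    using d_pos by (intro tendsto_intros assms) simp
  then show ?thesis by (simp add: scaled_point_def f_def)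
qed

text \<open>By \<open>no_third\<close> every third index is strictly better or strictly worse than i
  and j at the limit point, and strict comparisons persist nearby. The tie between i and j is
  decided by \<open>snd q \<in> {0..1}\<close> instead.\<close>

lemma scaled_cells_eventually:
  assumes h: "h \<longlonglongrightarrow> 0" and hij: "\<And>n. h n $ i > h n $ j" and q: "snd q \<in> {0..1}"
    and no_third: "\<forall>k. k \<noteq> i \<longrightarrow> k \<noteq> j \<longrightarrow> pot x z k (f (fst q)) \<noteq> pot x z i (f (fst q))"
  shows "eventually (\<lambda>n. scaled_point (h n) q \<in> laguerre_cell x (z + h n) i \<inter> laguerre_cell x z j
      \<longleftrightarrow> f (fst q) \<in> laguerre_cell x z i \<inter> laguerre_cell x z j) sequentially"
proof -
  let ?y = "\<lambda>n. scaled_point (h n) q" and ?w = "f (fst q)"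
  have lim: "(\<lambda>n. pot x z k (?y n)) \<longlonglongrightarrow> pot x z k ?w" for k
    unfolding pot_def by (intro tendsto_intros scaled_point_tendsto[OF h]) simp
  have limh: "(\<lambda>n. pot x (z + h n) k (?y n)) \<longlonglongrightarrow> pot x z k ?w" for k
  proof -
    have "(\<lambda>n. pot x z k (?y n) - h n $ k) \<longlonglongrightarrow> pot x z k ?w - (0::real^'n) $ k"
      by (intro tendsto_intros lim h)
    then show ?thesis by (simp add: pot_add)
  qed
  note ji = pot_eq_f[of "fst q"]
  show ?thesis
  proof (cases "\<exists>k. k \<noteq> i \<and> k \<noteq> j \<and> pot x z k ?w < pot x z i ?w")
    case True
    then obtain k where k: "pot x z k ?w < pot x z i ?w" by blast
    have "eventually (\<lambda>n. pot x z k (?y n) < pot x z j (?y n)) sequentially"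
      by (rule eventually_less_of_tendsto[OF lim lim]) (use k ji in simp)
    then show ?thesis
    proof (rule eventually_mono)
      fix n assume "pot x z k (?y n) < pot x z j (?y n)"
      then have "?y n \<notin> laguerre_cell x z j" unfolding laguerre_cell_iff by (meson not_le)
      moreover have "?w \<notin> laguerre_cell x z i" using k unfolding laguerre_cell_iff by (meson not_le)
      ultimately show "?y n \<in> laguerre_cell x (z + h n) i \<inter> laguerre_cell x z j
          \<longleftrightarrow> ?w \<in> laguerre_cell x z i \<inter> laguerre_cell x z j" by blast
    qed
  next
    case False
    then have gt: "pot x z i ?w < pot x z k ?w" if "k \<noteq> i" "k \<noteq> j" for k
      using no_third that by (meson linorder_neqE)
    have w: "?w \<in> laguerre_cell x z i \<inter> laguerre_cell x z j"
      unfolding Int_iff laguerre_cell_iff ji using gt ji by (metis less_imp_le order_refl)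
    have "eventually (\<lambda>n. \<forall>k. k \<noteq> i \<longrightarrow> k \<noteq> j \<longrightarrow>
        pot x (z + h n) i (?y n) < pot x (z + h n) k (?y n) \<and> pot x z j (?y n) < pot x z k (?y n)) sequentially"
    proof (rule eventually_all_finite)
      fix k
      show "eventually (\<lambda>n. k \<noteq> i \<longrightarrow> k \<noteq> j \<longrightarrow>
        pot x (z + h n) i (?y n) < pot x (z + h n) k (?y n) \<and> pot x z j (?y n) < pot x z k (?y n)) sequentially"
      proof (cases "k = i \<or> k = j")
        case False
        have "eventually (\<lambda>n. pot x (z + h n) i (?y n) < pot x (z + h n) k (?y n)) sequentially"
          by (rule eventually_less_of_tendsto[OF limh limh]) (use gt False in auto)
        moreover have "eventually (\<lambda>n. pot x z j (?y n) < pot x z k (?y n)) sequentially"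
          by (rule eventually_less_of_tendsto[OF lim lim]) (use gt False ji in auto)
        ultimately show ?thesis by eventually_elim auto
      qed auto
    qed
    then show ?thesis
    proof (rule eventually_mono)
      fix n
      assume k: "\<forall>k. k \<noteq> i \<longrightarrow> k \<noteq> j \<longrightarrow>
        pot x (z + h n) i (?y n) < pot x (z + h n) k (?y n) \<and> pot x z j (?y n) < pot x z k (?y n)"
      have diff: "pot x z j (?y n) - pot x z i (?y n) = - (h n $ i - h n $ j) * snd q"
        by (rule scaled_point_membership[OF hij refl])
      \<comment> \<open>The bounds on m are exactly the two comparisons needed: j against i for z,
        and i against j for z + h n.\<close>
      define m where "m = (h n $ i - h n $ j) * snd q"
      have "0 \<le> m" "m \<le> h n $ i - h n $ j"
        using hij[of n] q by (auto simp: m_def intro!: mult_nonneg_nonneg mult_left_le)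
      moreover have "pot x z j (?y n) - pot x z i (?y n) = - m" using diff unfolding m_def by (simp only: mult_minus_left)
      ultimately have le: "pot x z j (?y n) \<le> pot x z i (?y n)" "pot x (z + h n) i (?y n) \<le> pot x (z + h n) j (?y n)"
        unfolding pot_add by linarith+
      have "?y n \<in> laguerre_cell x (z + h n) i" "?y n \<in> laguerre_cell x z j"
        unfolding laguerre_cell_iff using k le by (metis less_imp_le order_refl)+
      then show "?y n \<in> laguerre_cell x (z + h n) i \<inter> laguerre_cell x z j
          \<longleftrightarrow> ?w \<in> laguerre_cell x z i \<inter> laguerre_cell x z j" using w by blast
    qed
  qed
qed

lemma AE_scaled_integrand_tendsto:
  assumes h: "h \<longlonglongrightarrow> 0" and hij: "\<And>n. h n $ i > h n $ j"
  shows "AE q in lborel. (\<lambda>n. scaled_integrand (h n) q) \<longlonglongrightarrow> limit_integrand q"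
  using AE_lborel_fst[OF AE_f_isCont_flux] AE_lborel_fst[OF AE_f_no_third_cell]
proof eventually_elim
  case (elim q)
  show ?case
  proof (cases "snd q \<in> {0..1}")
    case True
    have "(\<lambda>n. flux_density i j (scaled_point (h n) q)) \<longlonglongrightarrow> flux_density i j (f (fst q))"
      by (rule isCont_tendsto_compose[OF elim(1) scaled_point_tendsto[OF h]])
    moreover have "(\<lambda>n. indicator (laguerre_cell x (z + h n) i \<inter> laguerre_cell x z j) (scaled_point (h n) q) :: real)
      \<longlonglongrightarrow> indicator (laguerre_cell x z i \<inter> laguerre_cell x z j) (f (fst q))"
      by (rule tendsto_eventually, rule eventually_mono[OF scaled_cells_eventually[OF h hij True elim(2)]])
         (simp only: indicator_def)
    ultimately show ?thesis
      using True unfolding scaled_integrand_def limit_integrand_def by (simp add: tendsto_mult)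
  next
    case False
    then have "scaled_integrand (h n) q = 0" for n using scaled_integrand_eq_0[OF hij] by blast
    then show ?thesis using False by (simp add: limit_integrand_def)
  qed
qed

lemma exchange_quotient_tendsto:
  assumes h: "h \<longlonglongrightarrow> 0" and hij: "\<And>n. h n $ i > h n $ j"
  shows "(\<lambda>n. exchange i j (h n) / ((h n $ i - h n $ j) / d)) \<longlonglongrightarrow> interface i j"
proof -
  obtain w where w: "integrable lborel w"
    "\<And>h q. h $ i > h $ j \<Longrightarrow> norm (scaled_integrand h q) \<le> w q" by (rule scaled_integrand_dominated) blast
  have bound: "AE q in lborel. norm (scaled_integrand (h n) q) \<le> w q" for n
    by (rule AE_I2) (rule w(2)[OF hij])
  note lims = AE_scaled_integrand_tendsto[OF h hij]
  have int: "integrable lborel limit_integrand"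
    by (rule integrable_dominated_convergence[OF _ _ w(1) lims bound]) simp_all
  have lim: "(\<lambda>n. \<integral>q. scaled_integrand (h n) q \<partial>lborel) \<longlonglongrightarrow> (\<integral>q. limit_integrand q \<partial>lborel)"
    by (rule integral_dominated_convergence[OF _ _ w(1) lims bound]) simp_all
  have "(\<integral>q. limit_integrand q \<partial>lborel) = (\<integral>w. (\<integral>t. limit_integrand (w, t) \<partial>lborel) \<partial>lborel)"
    using lborel_pair.integral_fst'[of limit_integrand] int by (simp add: lborel_prod)
  also have "\<dots> = interface i j"
    unfolding interface_chart limit_integrand_def by simp
  finally have eq: "(\<integral>q. limit_integrand q \<partial>lborel) = interface i j" .
  have "exchange i j (h n) / ((h n $ i - h n $ j) / d) = (\<integral>q. scaled_integrand (h n) q \<partial>lborel)" for n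
    using exchange_scaled[OF hij] hij[of n] d_pos by simp
  then show ?thesis using lim unfolding eq by simp
qed

end

section \<open>First-order expansion\<close>

context dual_optimum
begin

lemma exchange_quotient_within:
  assumes ij: "i \<noteq> j"
  shows "((\<lambda>h. exchange i j h / ((h $ i - h $ j) / norm (x i - x j))) \<longlongrightarrow> interface i j)
    (at 0 within {h. h $ j < h $ i})"
proof -
  have DIM: "2 \<le> DIM('a)"
    using hausdorff_dimension_less(1)[OF phi_disc] by simp
  then have dim: "DIM('a) = DIM(real ^ 'a coord_idx) + 1"
    by (simp add: CARD_coord_idx)
  let ?u = "(x i - x j) /\<^sub>R norm (x i - x j)"
  have ne: "x i - x j \<noteq> 0" using ij x_inj by (simp add: inj_eq)
  then have "?u \<noteq> 0" by simp
  then obtain L :: "real ^ 'a coord_idx \<Rightarrow> 'a"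
    where L: "linear L" "\<And>w. norm (L w) = norm w" "range L = {y. inner ?u y = 0}"
    by (rule hyperplane_isometry[OF _ dim]) blast
  interpret bisector_chart x p R \<rho> Y \<phi> z L i j
  proof (intro bisector_chart.intro hyperplane_chart.intro bisector_chart_axioms.intro)
    show "norm ?u = 1" using ne by simp
  qed (rule dual_optimum_axioms L dim ij)+
  show ?thesis
    unfolding tendsto_at_iff_sequentially o_def
    using exchange_quotient_tendsto[unfolded d_def] by simp
qed

text \<open>The factor \<open>max 0\<close> joins the half-space where the quotient converges to its
  complement, where the exchange vanishes.\<close>

lemma exchange_first_order:
  "((\<lambda>h. (exchange i j h - max 0 ((h $ i - h $ j) / norm (x i - x j)) * interface i j) / norm h) \<longlongrightarrow> 0) (at 0)"
proof (cases "i = j")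
  case True
  then show ?thesis by (simp add: exchange_self)
next
  case ij: False
  define d where "d = norm (x i - x j)"
  have d: "d > 0" using ij x_inj by (auto simp: d_def inj_eq)
  show ?thesis
  proof (rule tendstoI)
    fix e :: real assume e: "e > 0"
    \<comment> \<open>The tolerance e d / 2 compensates (h i - h j) / d \<le> 2 |h| / d, which holds
      because each component is at most |h|.\<close>
    have "eventually (\<lambda>h. dist (exchange i j h / ((h $ i - h $ j) / d)) (interface i j) < e * d / 2)
        (at 0 within {h. h $ j < h $ i})"
      using exchange_quotient_within[OF ij] e d unfolding d_def by (intro tendstoD) auto
    then have "eventually (\<lambda>h. h $ j < h $ i \<longrightarrow>
        \<bar>exchange i j h / ((h $ i - h $ j) / d) - interface i j\<bar> < e * d / 2) (at 0)"
      unfolding eventually_at_filter by (auto simp: dist_real_def elim: eventually_mono)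
    moreover have "eventually (\<lambda>h::real^'n. h \<noteq> 0) (at 0)" by (simp add: eventually_at_filter)
    ultimately show "eventually (\<lambda>h. dist ((exchange i j h - max 0 ((h $ i - h $ j) / norm (x i - x j)) * interface i j) / norm h) 0 < e) (at 0)"
      unfolding d_def[symmetric]
    proof eventually_elim
      case (elim h)
      show ?case
      proof (cases "h $ j < h $ i")
        case True
        define s where "s = (h $ i - h $ j) / d"
        have s: "s > 0" using True d by (simp add: s_def)
        have q: "\<bar>exchange i j h / s - interface i j\<bar> < e * d / 2" using elim True by (simp add: s_def)
        have "h $ i - h $ j \<le> 2 * norm h"
          using component_le_norm_cart[of h i] component_le_norm_cart[of h j] by linarith
        then have s2: "s \<le> 2 * norm h / d" using d by (simp add: s_def divide_right_mono)
        have "\<bar>exchange i j h - s * interface i j\<bar> = s * \<bar>exchange i j h / s - interface i j\<bar>"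
          using s by (simp add: abs_mult[symmetric, of s, simplified abs_of_pos[OF s]] right_diff_distrib)
        also have "\<dots> < s * (e * d / 2)" using q s by simp
        also have "\<dots> \<le> (2 * norm h / d) * (e * d / 2)" using s2 e d by (intro mult_right_mono) auto
        also have "\<dots> = e * norm h" using d by simp
        finally show ?thesis
          using elim s by (simp add: s_def[symmetric] field_simps)
      next
        case False
        then have "max 0 ((h $ i - h $ j) / d) = 0" using d by (simp add: divide_le_0_iff)
        then show ?thesis using False exchange_eq_0[OF ij, of h] e by simp
      qed
    qed
  qed
qed

lemma gamma_first_order:
  "((\<lambda>h. (gamma_phi x R \<phi> (z + h) - gamma_phi x R \<phi> z
      - (\<Sum>i\<in>UNIV. \<Sum>j\<in>UNIV. max 0 ((h $ i - h $ j) / norm (x i - x j)) * interface i j)) / norm h) \<longlongrightarrow> 0) (at 0)"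
proof -
  have "((\<lambda>h. \<Sum>i\<in>UNIV. \<Sum>j\<in>UNIV. (exchange i j h
      - max 0 ((h $ i - h $ j) / norm (x i - x j)) * interface i j) / norm h) \<longlongrightarrow> 0) (at 0)"
    by (intro tendsto_null_sum exchange_first_order)
  then show ?thesis
    by (simp add: gamma_diff sum_subtractf sum_divide_distrib diff_divide_distrib)
qed

end

lemma sum_pairs_less:
  fixes t :: "'n::{finite,linorder} \<Rightarrow> 'n \<Rightarrow> real"
  assumes diag: "\<And>i. t i i = 0"
  shows "(\<Sum>i\<in>UNIV. \<Sum>j\<in>UNIV. t i j) = (\<Sum>(i, j)\<in>{(i, j). i < j}. t i j + t j i)"
proof -
  let ?P = "{(i, j). i < j} :: ('n \<times> 'n) set" and ?Q = "{(i, j). j < i} :: ('n \<times> 'n) set"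
  have "(\<Sum>i\<in>UNIV. \<Sum>j\<in>UNIV. t i j) = (\<Sum>(i, j)\<in>UNIV. t i j)"
    by (simp add: sum.cartesian_product)
  also have "\<dots> = (\<Sum>(i, j)\<in>?P \<union> ?Q. t i j)"
    by (rule sum.mono_neutral_right) (auto simp: diag not_less_iff_gr_or_eq)
  also have "\<dots> = (\<Sum>(i, j)\<in>?P. t i j) + (\<Sum>(i, j)\<in>?Q. t i j)"
    by (rule sum.union_disjoint) auto
  also have "(\<Sum>(i, j)\<in>?Q. t i j) = (\<Sum>(i, j)\<in>?P. t j i)"
    by (rule sum.reindex_bij_witness[of _ prod.swap prod.swap]) auto
  also have "(\<Sum>(i, j)\<in>?P. t i j) + (\<Sum>(i, j)\<in>?P. t j i)
      = (\<Sum>q\<in>?P. (case q of (i, j) \<Rightarrow> t i j) + (case q of (i, j) \<Rightarrow> t j i))"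
    by (rule sum.distrib[symmetric])
  also have "\<dots> = (\<Sum>(i, j)\<in>?P. t i j + t j i)"
    by (rule sum.cong) auto
  finally show ?thesis .
qed

theorem theorem1:
  fixes x :: "'n::{finite,linorder} \<Rightarrow> 'a::euclidean_space"
    and p :: "'n \<Rightarrow> real"
    and R :: "'a measure"
    and \<rho> :: "'a \<Rightarrow> real"
    and Y :: "'a set"
    and \<phi> :: "'a \<Rightarrow> 'a"
    and zstar :: "real^('n::{finite,linorder})"
  assumes x_distinct: "inj x"
    and p_pos: "\<And>i. p i > 0"
    and p_sum: "(\<Sum>i\<in>UNIV. p i) = 1"
    \<comment> \<open>Assumption A1\<close>
    and R_density: "R = density lborel (\<lambda>y. ennreal (\<rho> y))"
    and R_prob: "prob_space R"
    and rho_meas: "\<rho> \<in> borel_measurable borel"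
    and rho_nonneg: "\<And>y. \<rho> y \<ge> 0"
    and Y_compact: "compact Y"
    and Y_convex: "convex Y"
    and rho_cont: "continuous_on Y \<rho>"
    and rho_zero: "\<And>y. y \<notin> Y \<Longrightarrow> \<rho> y = 0"
    and Y_boundary: "polyhedron Y \<or>
        (\<forall>a b. a \<noteq> 0 \<longrightarrow>
            hausdorff_outer (real DIM('a) - 1) (frontier Y \<inter> {y. inner a y = b}) = 0)"
    \<comment> \<open>Assumption A3\<close>
    and phi_meas: "\<phi> \<in> borel_measurable borel"
    and phi_bounded: "bounded (range \<phi>)"
    and phi_disc: "hausdorff_dimension {y. \<not> isCont \<phi> y} < real DIM('a) - 1"
    \<comment> \<open>z* optimal for the dual problem (D)\<close>
    and zstar_opt: "\<And>z. dual_obj x p R z \<le> dual_obj x p R zstar"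
  shows "(gamma_phi x R \<phi> has_derivative
           (\<lambda>h. \<Sum>(i, j) \<in> {(i, j). i < j}.
              (h $ i - h $ j) / norm (x i - x j) *
              (\<integral>y. indicator (laguerre_cell x zstar i \<inter> laguerre_cell x zstar j) y *
                    (inner (x i - x j) (\<phi> y) * \<rho> y)
                 \<partial>hausdorff_measure (real DIM('a) - 1))))
         (at zstar)"
proof -
  interpret dual_optimum x p R \<rho> Y \<phi> zstar
    using assms by (simp add: dual_optimum_def)
  let ?D = "\<lambda>h. \<Sum>(i, j) \<in> {(i, j). i < j}. (h $ i - h $ j) / norm (x i - x j) * interface i j"
  have "(\<Sum>i\<in>UNIV. \<Sum>j\<in>UNIV. max 0 ((h $ i - h $ j) / norm (x i - x j)) * interface i j) = ?D h" for h :: "real^('n::{finite,linorder})"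
  proof -
    have "max 0 ((h $ i - h $ j) / norm (x i - x j)) * interface i j
        + max 0 ((h $ j - h $ i) / norm (x j - x i)) * interface j i
        = (h $ i - h $ j) / norm (x i - x j) * interface i j" for i j
    proof -
      have "(h $ j - h $ i) / norm (x j - x i) = - ((h $ i - h $ j) / norm (x i - x j))"
        by (simp add: norm_minus_commute minus_divide_left)
      moreover have "max 0 a * b + max 0 (- a) * (- b) = a * b" for a b :: real
        by (simp add: max_def)
      ultimately show ?thesis unfolding interface_swap[of j i] by simp
    qed
    then show ?thesis by (subst sum_pairs_less) auto
  qed
  then have lim: "((\<lambda>h. (gamma_phi x R \<phi> (zstar + h) - gamma_phi x R \<phi> zstar - ?D h) / norm h) \<longlongrightarrow> 0) (at 0)"
    using gamma_first_order by simp
  have "bounded_linear ?D"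
  proof (rule bounded_linear_sum)
    fix q :: "'n \<times> 'n"
    have "linear (\<lambda>h::real^('n::{finite,linorder}). (h $ i - h $ j) / norm (x i - x j) * interface i j)" for i j
      by (rule linearI) (simp_all add: algebra_simps add_divide_distrib diff_divide_distrib)
    then show "bounded_linear (\<lambda>h::real^('n::{finite,linorder}). case q of (i, j) \<Rightarrow> (h $ i - h $ j) / norm (x i - x j) * interface i j)"
      by (cases q) (simp add: linear_conv_bounded_linear)
  qed
  moreover have "((\<lambda>h. norm (gamma_phi x R \<phi> (zstar + h) - gamma_phi x R \<phi> zstar - ?D h) / norm h) \<longlongrightarrow> 0) (at 0)"
    using tendsto_norm_zero[OF lim] by simp
  ultimately have "(gamma_phi x R \<phi> has_derivative ?D) (at zstar)"
    unfolding has_derivative_at by blast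
  then show ?thesis unfolding interface_def flux_density_def .
qed

end
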